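(* Let $B$ be the unit ball of $\mathbb{C}^2$. The function $u(z)=\max\{\log|z|,-1\}$ on $B$ is extremal.
   Context: $|z|$ is the Euclidean norm on $\mathbb{C}^2$. Let $C$ be the convex cone of negative (i.e. $\le 0$) plurisubharmonic functions on $B$. A function $u\in C$ is called extremal if whenever $u=u_1+u_2$ with $u_1,u_2\in C$, there are constants $\lambda_1,\lambda_2\ge 0$ with $u_1=\lambda_1u$ and $u_2=\lambda_2u$. *)

theory Defs
  imports "HOL-Analysis.Analysis"
begin

definition usc_on :: "'a::topological_space set \<Rightarrow> ('a \<Rightarrow> ereal) \<Rightarrow> bool" where
  "usc_on U u \<longleftrightarrow> (\<forall>c. openin (top_of_set U) {x \<in> U. u x < c})"

(* Mean over the circle of centre c and radius r, with respect to normalised arc length. It is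
   written as positive part minus negative part so that it can take the value -\<infinity>. For u upper
   semicontinuous and < \<infinity> on the circle, the positive part is bounded, so the difference is never
   the indeterminate \<infinity> - \<infinity>. *)
definition circle_mean :: "(complex \<Rightarrow> ereal) \<Rightarrow> complex \<Rightarrow> real \<Rightarrow> ereal" where
  "circle_mean u c r =
     (enn2ereal (\<integral>\<^sup>+ t \<in> {0..2 * pi}. e2ennreal (u (c + of_real r * cis t)) \<partial>lborel)
      - enn2ereal (\<integral>\<^sup>+ t \<in> {0..2 * pi}. e2ennreal (- u (c + of_real r * cis t)) \<partial>lborel))
     / ereal (2 * pi)"

(* The function that is identically -\<infinity> is allowed. *)
definition subharmonic_on :: "complex set \<Rightarrow> (complex \<Rightarrow> ereal) \<Rightarrow> bool" where
  "subharmonic_on U u \<longleftrightarrow>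
     open U \<and> (\<forall>z\<in>U. u z < \<infinity>) \<and> usc_on U u \<and>
     (\<forall>c r. r > 0 \<and> cball c r \<subseteq> U \<longrightarrow> u c \<le> circle_mean u c r)"

definition psh_on :: "(complex ^ 'n) set \<Rightarrow> (complex ^ 'n \<Rightarrow> ereal) \<Rightarrow> bool" where
  "psh_on U u \<longleftrightarrow>
     open U \<and> (\<forall>z\<in>U. u z < \<infinity>) \<and> usc_on U u \<and>
     (\<forall>a b. subharmonic_on {t. a + t *s b \<in> U} (\<lambda>t. u (a + t *s b)))"

(* Functions on U are represented by total functions; values outside U are irrelevant. *)
definition neg_psh_cone :: "(complex ^ 'n) set \<Rightarrow> (complex ^ 'n \<Rightarrow> ereal) set" where
  "neg_psh_cone U = {u. psh_on U u \<and> (\<forall>z\<in>U. u z \<le> 0)}"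

definition extremal_on :: "(complex ^ 'n) set \<Rightarrow> (complex ^ 'n \<Rightarrow> ereal) \<Rightarrow> bool" where
  "extremal_on U u \<longleftrightarrow>
     u \<in> neg_psh_cone U \<and>
     (\<forall>u1\<in>neg_psh_cone U. \<forall>u2\<in>neg_psh_cone U.
        (\<forall>z\<in>U. u z = u1 z + u2 z) \<longrightarrow>
        (\<exists>l1 l2 :: real. l1 \<ge> 0 \<and> l2 \<ge> 0 \<and>
           (\<forall>z\<in>U. u1 z = ereal l1 * u z) \<and> (\<forall>z\<in>U. u2 z = ereal l2 * u z)))"

(* log |z| with log 0 = -\<infinity>; the library has ln 0 = 0. *)
definition log_norm :: "'a::real_normed_vector \<Rightarrow> ereal" where
  "log_norm z = (if z = 0 then -\<infinity> else ereal (ln (norm z)))"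

end

theory Submission
  imports Defs "HOL-Complex_Analysis.Complex_Analysis"
begin

text \<open>
The truncated logarithm \<open>u = max (log (norm z)) (- 1)\<close> is constant on the inner ball of radius
\<open>exp (- 1)\<close> and harmonic along complex lines through the origin in the shell outside it. If
\<open>u = u1 + u2\<close> with negative plurisubharmonic summands, then on every disc on which \<open>u\<close> is harmonic both
summands are harmonic as well, because two nonnegative excesses of mean over central value add up to zero.
So \<open>u1\<close> is pluriharmonic in the inner ball, harmonic along radial lines in the shell, and zero on the
unit sphere: its values in the inner ball determine it. In one variable such a \<open>u1\<close> need not be a multiple
of \<open>u\<close>. In two variables the radial lines are tied together: since in the shell the complex Hessian of \<open>u\<close>
vanishes in the radial direction, and both summands have nonnegative Hessian, the mixed radial-tangential entries of the
Hessian of \<open>u1\<close> vanish too.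

To use this without distributions, everything is expressed by means over circles. The excess of the
mean over the central value (\<open>mean_gap\<close>) of \<open>u1\<close> lies between 0 and that of \<open>u\<close>. The
resulting bound \<open>norm (mean_gap f a b) \<le> mean_gap trunc_log a b\<close> (\<open>dominated\<close>) passes to Fourier components under
the torus of coordinate rotations (\<open>dominated_fourier\<close>). A component with nontrivial character is, up to
conjugation, a multiple of \<open>z1 ^ m * z2 ^ n\<close> in the inner ball and hence a multiple of
\<open>z1 ^ m * z2 ^ n * (1 - 1 / (norm z) ^ (2 (m + n)))\<close> in the shell (\<open>character_component_zero_pos\<close>).
Displacing a radial disc by a tangential vector of length \<open>e\<close> changes the gap of \<open>u\<close> by order \<open>e\<^sup>2\<close> but the
gap of such a function by order \<open>e\<close>, unless it is zero (\<open>monomial_coefficient_zero\<close>). Hence \<open>u1\<close> is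
invariant under the torus, and then it is \<open>- u1 0\<close> times \<open>u\<close> (\<open>dominated_eq_multiple\<close>).
\<close>

section \<open>Averages over the unit circle\<close>

definition circ_avg :: "(complex \<Rightarrow> 'a::banach) \<Rightarrow> 'a" where
  "circ_avg g = (1 / (2 * pi)) *\<^sub>R integral {0..2 * pi} (\<lambda>t. g (cis t))"

lemma cis_integrable:
  fixes g :: "complex \<Rightarrow> 'a::banach"
  assumes "continuous_on (sphere 0 1) g"
  shows "(\<lambda>t. g (cis t)) integrable_on {a..b}"
proof -
  have "continuous_on {a..b} (\<lambda>t. g (cis t))"
    by (rule continuous_on_compose2[OF assms]) (auto intro!: continuous_intros)
  then show ?thesis by (rule integrable_continuous_real)
qed

lemma circ_avg_cong:
  assumes "\<And>\<omega>. norm \<omega> = 1 \<Longrightarrow> g \<omega> = h \<omega>"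
  shows "circ_avg g = circ_avg h"
  unfolding circ_avg_def using assms by simp

lemma circ_avg_const [simp]: "circ_avg (\<lambda>\<omega>. c) = c"
  unfolding circ_avg_def by simp

lemma circ_avg_add:
  assumes "continuous_on (sphere 0 1) g" "continuous_on (sphere 0 1) h"
  shows "circ_avg (\<lambda>\<omega>. g \<omega> + h \<omega>) = circ_avg g + circ_avg h"
  unfolding circ_avg_def
  by (simp add: integral_add[OF cis_integrable[OF assms(1)] cis_integrable[OF assms(2)]] scaleR_add_right)

lemma circ_avg_diff:
  assumes "continuous_on (sphere 0 1) g" "continuous_on (sphere 0 1) h"
  shows "circ_avg (\<lambda>\<omega>. g \<omega> - h \<omega>) = circ_avg g - circ_avg h"
  unfolding circ_avg_def
  by (simp add: integral_diff[OF cis_integrable[OF assms(1)] cis_integrable[OF assms(2)]] scaleR_diff_right)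

lemma circ_avg_linear:
  fixes T :: "'a::banach \<Rightarrow> 'b::banach"
  assumes "bounded_linear T" "continuous_on (sphere 0 1) g"
  shows "circ_avg (\<lambda>\<omega>. T (g \<omega>)) = T (circ_avg g)"
proof -
  interpret bounded_linear T by fact
  show ?thesis
    unfolding circ_avg_def
    using integral_linear[OF cis_integrable[OF assms(2)] assms(1), of 0 "2*pi"]
    by (simp add: o_def scaleR)
qed

lemmas circ_avg_mult_left = circ_avg_linear[OF bounded_linear_mult_right]
lemmas circ_avg_mult_right = circ_avg_linear[OF bounded_linear_mult_left]
lemmas circ_avg_cnj = circ_avg_linear[OF bounded_linear_cnj]
lemmas circ_avg_Re = circ_avg_linear[OF bounded_linear_Re]
lemmas circ_avg_of_real = circ_avg_linear[OF bounded_linear_of_real]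

lemma circ_avg_mono:
  fixes g h :: "complex \<Rightarrow> real"
  assumes "continuous_on (sphere 0 1) g" "continuous_on (sphere 0 1) h"
    and "\<And>\<omega>. norm \<omega> = 1 \<Longrightarrow> g \<omega> \<le> h \<omega>"
  shows "circ_avg g \<le> circ_avg h"
proof -
  have "integral {0..2 * pi} (\<lambda>t. g (cis t)) \<le> integral {0..2 * pi} (\<lambda>t. h (cis t))"
    by (intro integral_le cis_integrable assms) auto
  then show ?thesis unfolding circ_avg_def by (simp add: divide_right_mono)
qed

lemma norm_circ_avg_le:
  fixes g :: "complex \<Rightarrow> 'a::banach"
  assumes "continuous_on (sphere 0 1) g" "continuous_on (sphere 0 1) h"
    and "\<And>\<omega>. norm \<omega> = 1 \<Longrightarrow> norm (g \<omega>) \<le> h \<omega>"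
  shows "norm (circ_avg g) \<le> circ_avg h"
proof -
  have "norm (integral {0..2 * pi} (\<lambda>t. g (cis t))) \<le> integral {0..2 * pi} (\<lambda>t. h (cis t))"
    by (intro integral_norm_bound_integral cis_integrable assms) auto
  then show ?thesis unfolding circ_avg_def by (simp add: divide_right_mono)
qed

lemma circ_avg_eq_0_imp:
  fixes g :: "complex \<Rightarrow> real"
  assumes "continuous_on (sphere 0 1) g" "\<And>\<omega>. norm \<omega> = 1 \<Longrightarrow> 0 \<le> g \<omega>"
    and "circ_avg g = 0" and "norm \<omega> = 1"
  shows "g \<omega> = 0"
proof -
  have c: "continuous_on {0..2 * pi} (\<lambda>t. g (cis t))"
    by (rule continuous_on_compose2[OF assms(1)]) (auto intro!: continuous_intros)
  have "((\<lambda>t. g (cis t)) has_integral 0) {0..2 * pi}"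
    using cis_integrable[OF assms(1), of 0 "2*pi"] assms(3)
    by (simp add: circ_avg_def has_integral_integrable_integral)
  moreover obtain t where "0 \<le> t" "t < 2 * pi" "\<omega> = cis t"
  proof -
    have "\<omega> \<noteq> 0" using assms(4) by auto
    then have "\<omega> = cis (Arg2pi \<omega>)"
      using Arg2pi_eq[of \<omega>] assms(4) by (simp add: cis_conv_exp)
    then show ?thesis using that Arg2pi[of \<omega>] by blast
  qed
  ultimately show ?thesis
    using has_integral_0_cbox_imp_0[of 0 "2*pi" "\<lambda>t. g (cis t)" t] c assms(2) by auto
qed

lemma circ_avg_swap:
  fixes h :: "complex \<Rightarrow> complex \<Rightarrow> 'a::banach"
  assumes "continuous_on (sphere 0 1 \<times> sphere 0 1) (\<lambda>(\<omega>, \<eta>). h \<omega> \<eta>)"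
  shows "circ_avg (\<lambda>\<omega>. circ_avg (\<lambda>\<eta>. h \<omega> \<eta>)) = circ_avg (\<lambda>\<eta>. circ_avg (\<lambda>\<omega>. h \<omega> \<eta>))"
proof -
  have "continuous_on (cbox (0, 0) (2 * pi, 2 * pi)) (\<lambda>(s, t). h (cis s) (cis t))"
    unfolding case_prod_unfold
    by (rule continuous_on_compose2[OF assms[unfolded case_prod_unfold],
          of _ "\<lambda>p. (cis (fst p), cis (snd p))", simplified]) (auto intro!: continuous_intros)
  from integral_swap_continuous[OF this] show ?thesis
    unfolding circ_avg_def by simp
qed

lemma continuous_on_circ_avg:
  fixes h :: "'c::topological_space \<Rightarrow> complex \<Rightarrow> 'a::banach"
  assumes "continuous_on (U \<times> sphere 0 1) (\<lambda>(x, \<omega>). h x \<omega>)"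
  shows "continuous_on U (\<lambda>x. circ_avg (h x))"
proof -
  have "continuous_on (U \<times> cbox 0 (2 * pi)) (\<lambda>(x, t). h x (cis t))"
    unfolding case_prod_unfold
    by (rule continuous_on_compose2[OF assms[unfolded case_prod_unfold],
          of _ "\<lambda>p. (fst p, cis (snd p))", simplified]) (auto intro!: continuous_intros)
  from integral_continuous_on_param[OF this] show ?thesis
    unfolding circ_avg_def by (intro continuous_intros) simp
qed

lemma circ_avg_rotate:
  fixes g :: "complex \<Rightarrow> 'a::banach"
  assumes g: "continuous_on (sphere 0 1) g" and \<eta>: "norm \<eta> = 1"
  shows "circ_avg (\<lambda>\<omega>. g (\<eta> * \<omega>)) = circ_avg g"
proof -
  have "\<eta> \<noteq> 0" using \<eta> by auto
  then obtain s where s: "0 \<le> s" "s < 2 * pi" "\<eta> = cis s"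
    using Arg2pi_eq[of \<eta>] \<eta> Arg2pi[of \<eta>] by (metis cis_conv_exp mult_1 of_real_1)
  let ?G = "\<lambda>t. g (cis t)"
  have int: "?G integrable_on {a..b}" for a b by (rule cis_integrable[OF g])
  have "integral {0..2 * pi} (\<lambda>t. g (\<eta> * cis t)) = integral {0..2 * pi} (\<lambda>t. ?G (t + s))"
    by (simp add: s cis_mult add.commute)
  also have "\<dots> = integral {s..2 * pi + s} ?G"
    using integral_shift_real_ivl[of s s "2 * pi + s" ?G] by simp
  also have "\<dots> = integral {s..2 * pi} ?G + integral {2 * pi..2 * pi + s} ?G"
    using Henstock_Kurzweil_Integration.integral_combine[OF _ _ int, of s "2*pi" "2*pi+s"] s by simp
  also have "integral {2 * pi..2 * pi + s} ?G = integral {0..s} (\<lambda>t. ?G (t + 2 * pi))"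
    using integral_shift_real_ivl[of "2*pi" "2*pi" "2 * pi + s" ?G] by simp
  also have "\<dots> = integral {0..s} ?G"
    by (simp add: cis_mult[symmetric])
  also have "integral {s..2 * pi} ?G + integral {0..s} ?G = integral {0..2 * pi} ?G"
    using Henstock_Kurzweil_Integration.integral_combine[OF _ _ int, of 0 s "2*pi"] s
    by (simp add: add.commute)
  finally show ?thesis unfolding circ_avg_def by simp
qed

text \<open>
On the unit circle \<open>d\<omega> = \<i> \<omega> dt\<close>, so this is Cauchy's formula for \<open>F \<omega> / (\<omega> - w)\<close>. The case
\<open>w = 0\<close> is the mean value property; a nonzero \<open>w\<close> serves to evaluate a non-harmonic average exactly
in \<open>circ_avg_mixed_power\<close>.
\<close>

lemma circ_avg_Cauchy:
  assumes F: "F holomorphic_on S" "open S" "cball 0 1 \<subseteq> S" and w: "norm w < 1"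
  shows "circ_avg (\<lambda>\<omega>. F \<omega> * \<omega> / (\<omega> - w)) = F w"
proof -
  have "((\<lambda>u. F u / (u - w)) has_contour_integral (2 * of_real pi * \<i> * F w)) (circlepath 0 1)"
    by (rule Cauchy_integral_circlepath_simple)
       (use F w in \<open>auto intro: holomorphic_on_subset\<close>)
  then have "((\<lambda>t. F (cis t) / (cis t - w) * \<i> * cis t) has_integral (2 * of_real pi * \<i> * F w)) {0..2*pi}"
    unfolding circlepath_def by (subst (asm) has_contour_integral_part_circlepath_iff) auto
  from has_integral_mult_right[OF this, of "- \<i>"]
  have "((\<lambda>t. F (cis t) * cis t / (cis t - w)) has_integral (2 * of_real pi * F w)) {0..2*pi}"
    by (simp add: field_simps)
  then show ?thesis unfolding circ_avg_def
    by (simp add: integral_unique scaleR_conv_of_real)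
qed

lemma circ_avg_holomorphic:
  assumes F: "F holomorphic_on S" "open S" "cball c (norm b) \<subseteq> S"
  shows "circ_avg (\<lambda>\<omega>. F (c + \<omega> * b)) = F c"
proof -
  define T where "T = (\<lambda>\<omega>. c + \<omega> * b) -` S"
  have "open T" unfolding T_def
    by (intro open_vimage F continuous_intros)
  moreover have "cball 0 1 \<subseteq> T"
  proof
    fix x :: complex assume "x \<in> cball 0 1"
    then have "c + x * b \<in> cball c (norm b)"
      by (simp add: dist_norm norm_mult mult_left_le_one_le)
    then show "x \<in> T" using F unfolding T_def by auto
  qed
  moreover have "(\<lambda>\<omega>. c + \<omega> * b) holomorphic_on T"
    by (intro holomorphic_intros)
  then have "(\<lambda>\<omega>. F (c + \<omega> * b)) holomorphic_on T"
    using holomorphic_on_compose_gen[of "\<lambda>\<omega>. c + \<omega> * b" T F S] F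
    by (auto simp: T_def o_def)
  ultimately have "circ_avg (\<lambda>\<omega>. F (c + \<omega> * b) * \<omega> / (\<omega> - 0)) = F (c + 0 * b)"
    by (intro circ_avg_Cauchy[of _ T]) auto
  moreover have "circ_avg (\<lambda>\<omega>. F (c + \<omega> * b) * \<omega> / (\<omega> - 0)) = circ_avg (\<lambda>\<omega>. F (c + \<omega> * b))"
    by (rule circ_avg_cong) (auto simp: field_simps)
  ultimately show ?thesis by simp
qed

section \<open>The circle mean value property and Fourier uniqueness\<close>

text \<open>
The harmonic continuation into the disc of the character \<open>\<omega> powi k\<close> of the unit circle, so that one
function carries both the Fourier coefficients and the harmonic functions with given symmetry.
\<close>

definition hpow :: "int \<Rightarrow> complex \<Rightarrow> complex" where
  "hpow k w = (if k \<ge> 0 then w ^ nat k else cnj w ^ nat (- k))"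

lemma hpow_mult: "hpow k (a * b) = hpow k a * hpow k b"
  by (simp add: hpow_def power_mult_distrib)

lemma norm_hpow: "norm (hpow k w) = norm w ^ nat \<bar>k\<bar>"
  by (simp add: hpow_def norm_power)

lemma hpow_0 [simp]: "hpow 0 w = 1"
  by (simp add: hpow_def)

lemma cnj_hpow: "cnj (hpow k w) = hpow (- k) w"
  by (cases "k = 0") (auto simp: hpow_def)

lemma continuous_on_hpow [continuous_intros]:
  "continuous_on S f \<Longrightarrow> continuous_on S (\<lambda>x. hpow k (f x))"
  by (cases "k \<ge> 0") (simp_all add: hpow_def continuous_intros)

lemma hpow_eq_powi:
  assumes "norm \<omega> = 1"
  shows "hpow k \<omega> = \<omega> powi k"
proof -
  have "cnj \<omega> = inverse \<omega>"
    using assms by (simp add: complex_eq_iff inverse_complex.code cmod_def power2_eq_square)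
  then show ?thesis by (simp add: hpow_def power_int_def)
qed

lemma hpow_add:
  assumes "norm \<omega> = 1"
  shows "hpow (j + k) \<omega> = hpow j \<omega> * hpow k \<omega>"
proof -
  have "\<omega> \<noteq> 0" using assms by auto
  then show ?thesis by (simp add: hpow_eq_powi[OF assms] power_int_add)
qed

lemma hpow_minus_cancel:
  assumes "norm \<omega> = 1"
  shows "hpow k \<omega> * hpow (- k) \<omega> = 1"
  using hpow_add[OF assms, of k "- k"] by simp

text \<open>
For continuous functions this is harmonicity. Stated without derivatives, it passes directly between
means over circles and the maximum principle.
\<close>

definition mean_valued_on :: "complex set \<Rightarrow> (complex \<Rightarrow> complex) \<Rightarrow> bool" where
  "mean_valued_on S g \<longleftrightarrow>
     (\<forall>c r. 0 < r \<and> cball c r \<subseteq> S \<longrightarrow> circ_avg (\<lambda>\<omega>. g (c + \<omega> * of_real r)) = g c)"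

lemma affine_in_cball:
  fixes c :: complex
  assumes "norm \<omega> \<le> 1" "0 \<le> r" shows "c + \<omega> * of_real r \<in> cball c r"
  using assms by (simp add: dist_norm norm_mult mult_left_le_one_le)

lemma continuous_on_circle:
  fixes c :: complex
  assumes "continuous_on S g" "cball c r \<subseteq> S" "0 \<le> r"
  shows "continuous_on (sphere 0 1) (\<lambda>\<omega>. g (c + \<omega> * of_real r))"
proof (rule continuous_on_compose2[OF assms(1)])
  show "(\<lambda>\<omega>. c + \<omega> * of_real r) ` sphere 0 1 \<subseteq> S"
    using assms affine_in_cball[of _ r c] by fastforce
qed (intro continuous_intros)

lemma mean_valued_diff:
  assumes "mean_valued_on S f" "mean_valued_on S g" "continuous_on S f" "continuous_on S g"
  shows "mean_valued_on S (\<lambda>z. f z - g z)"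
  using assms unfolding mean_valued_on_def
  by (auto simp: circ_avg_diff continuous_on_circle)

lemma mean_valued_cmult:
  assumes "mean_valued_on S f" "continuous_on S f"
  shows "mean_valued_on S (\<lambda>z. a * f z)"
  using assms unfolding mean_valued_on_def
  by (auto simp: circ_avg_mult_left continuous_on_circle)

lemma mean_valued_cnj:
  assumes "mean_valued_on S f" "continuous_on S f"
  shows "mean_valued_on S (\<lambda>z. cnj (f z))"
  using assms unfolding mean_valued_on_def
  by (auto simp: circ_avg_cnj continuous_on_circle)

lemma mean_valued_holomorphic:
  assumes "f holomorphic_on S" "open S"
  shows "mean_valued_on S f"
  unfolding mean_valued_on_def using circ_avg_holomorphic[OF assms] by auto

lemma mean_valued_subset: "mean_valued_on S f \<Longrightarrow> T \<subseteq> S \<Longrightarrow> mean_valued_on T f"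
  unfolding mean_valued_on_def by blast

lemma mean_valued_hpow: "mean_valued_on S (hpow k)"
proof -
  have *: "mean_valued_on UNIV (\<lambda>w. w ^ n)" for n
    by (intro mean_valued_holomorphic holomorphic_intros) auto
  have "mean_valued_on UNIV (\<lambda>w. cnj (w ^ n))" for n
    by (intro mean_valued_cnj * continuous_intros)
  then have "mean_valued_on UNIV (hpow k)"
    using * unfolding hpow_def by (cases "k \<ge> 0") auto
  then show ?thesis by (rule mean_valued_subset) auto
qed

text \<open>
The closed disc misses the origin, so \<open>ln (norm z)\<close> is the real part of a branch of the logarithm
there.
\<close>

lemma circ_avg_ln_norm:
  assumes "0 \<notin> cball c r" "0 \<le> r"
  shows "circ_avg (\<lambda>\<omega>. ln (norm (c + \<omega> * of_real r))) = ln (norm c)"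
proof -
  have c: "c \<noteq> 0" "r < norm c" using assms by (auto simp: dist_norm)
  define b where "b = of_real r / c"
  have b: "norm b < 1" using c assms by (simp add: b_def norm_divide)
  have pos: "0 < Re z" if "z \<in> ball 1 1" for z :: complex
    using that abs_Re_le_cmod[of "1 - z"] by (simp add: dist_norm)
  have *: "circ_avg (\<lambda>\<omega>. Ln (1 + \<omega> * b)) = Ln 1"
    by (rule circ_avg_holomorphic[of _ "ball 1 1"])
       (use b pos in \<open>force intro!: holomorphic_intros simp: complex_nonpos_Reals_iff\<close>)+
  have in1: "1 + \<omega> * b \<in> ball 1 1" if "norm \<omega> = 1" for \<omega>
    using that b by (simp add: dist_norm norm_mult)
  have cont: "continuous_on (sphere 0 1) (\<lambda>\<omega>. Ln (1 + \<omega> * b))"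
    using pos[OF in1] by (intro continuous_intros) (force simp: complex_nonpos_Reals_iff)
  have "circ_avg (\<lambda>\<omega>. ln (norm (c + \<omega> * of_real r))) = circ_avg (\<lambda>\<omega>. ln (norm c) + Re (Ln (1 + \<omega> * b)))"
  proof (rule circ_avg_cong)
    fix \<omega> :: complex assume \<omega>: "norm \<omega> = 1"
    have nz: "1 + \<omega> * b \<noteq> 0" using pos[OF in1[OF \<omega>]] by (metis less_irrefl zero_complex.sel(1))
    have "c + \<omega> * of_real r = c * (1 + \<omega> * b)" using c by (simp add: b_def field_simps)
    then show "ln (norm (c + \<omega> * of_real r)) = ln (norm c) + Re (Ln (1 + \<omega> * b))"
      using c nz by (simp add: norm_mult ln_mult)
  qed
  also have "\<dots> = ln (norm c) + Re (circ_avg (\<lambda>\<omega>. Ln (1 + \<omega> * b)))"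
    using cont by (simp add: circ_avg_add circ_avg_Re continuous_intros)
  finally show ?thesis using * by simp
qed

lemma mean_valued_ln: "0 \<notin> S \<Longrightarrow> mean_valued_on S (\<lambda>z. of_real (ln (norm z)))"
  unfolding mean_valued_on_def
proof (intro allI impI, elim conjE)
  fix c r assume S: "0 \<notin> S" "(0::real) < r" "cball c r \<subseteq> S"
  then have 0: "0 \<notin> cball c r" by blast
  have "continuous_on (cball c r) (\<lambda>z. ln (norm z))"
    using 0 by (intro continuous_intros) auto
  from continuous_on_circle[OF this, of c r] S
  have "continuous_on (sphere 0 1) (\<lambda>\<omega>. ln (norm (c + \<omega> * of_real r)))" by simp
  then show "circ_avg (\<lambda>\<omega>. complex_of_real (ln (norm (c + \<omega> * of_real r)))) = of_real (ln (norm c))"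
    using circ_avg_ln_norm[OF 0] S by (simp add: circ_avg_of_real)
qed

text \<open>
At the point of largest real part where \<open>norm g\<close> is maximal, the average over a small circle can
equal the maximum only if the whole circle lies in the maximum set, which has no point further right.
\<close>

lemma maximum_principle:
  assumes K: "compact K" and S: "open S" "S \<subseteq> K" and g: "continuous_on K g"
    and mv: "mean_valued_on S g" and bd: "\<And>z. z \<in> K - S \<Longrightarrow> g z = 0" and z: "z \<in> K"
  shows "g z = 0"
proof (rule ccontr)
  assume nz: "g z \<noteq> 0"
  have ng: "continuous_on K (\<lambda>x. norm (g x))" by (intro continuous_intros g)
  obtain m where m: "m \<in> K" "\<And>x. x \<in> K \<Longrightarrow> norm (g x) \<le> norm (g m)"
    using continuous_attains_sup[OF K _ ng] z by auto
  define A where "A = K \<inter> (\<lambda>x. norm (g x)) -` {norm (g m)}"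
  have "compact A" unfolding A_def
    using K continuous_closed_preimage[OF ng compact_imp_closed[OF K], of "{norm (g m)}"]
    by (metis closed_singleton compact_Int_closed inf.absorb_iff2 inf_le1)
  moreover have "A \<noteq> {}" using m unfolding A_def by auto
  ultimately obtain p where p: "p \<in> A" "\<And>x. x \<in> A \<Longrightarrow> Re x \<le> Re p"
    using continuous_attains_sup[of A Re] continuous_on_Re[OF continuous_on_id] by blast
  have gm: "norm (g m) > 0" using m(2)[OF z] nz by (smt (verit) zero_less_norm_iff)
  have pK: "p \<in> K" "norm (g p) = norm (g m)" using p unfolding A_def by auto
  then have "p \<in> S" using bd[of p] gm by fastforce
  then obtain r where r: "r > 0" "cball p r \<subseteq> S" using S open_contains_cball by metis
  let ?h = "\<lambda>\<omega>. g (p + \<omega> * of_real r)"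
  have inK: "p + \<omega> * of_real r \<in> K" if "norm \<omega> = 1" for \<omega>
    using affine_in_cball[of \<omega> r p] that r S by auto
  have hc: "continuous_on (sphere 0 1) ?h"
    using continuous_on_circle[OF g, of p r] r S by auto
  have "norm (g m) = norm (circ_avg ?h)"
    using mv r pK unfolding mean_valued_on_def by simp
  also have "\<dots> \<le> circ_avg (\<lambda>\<omega>. norm (?h \<omega>))"
    by (rule norm_circ_avg_le) (auto intro!: continuous_intros hc)
  finally have "circ_avg (\<lambda>\<omega>. norm (g m) - norm (?h \<omega>)) \<le> 0"
    by (subst circ_avg_diff) (auto intro!: continuous_intros hc)
  moreover have "0 \<le> circ_avg (\<lambda>\<omega>. norm (g m) - norm (?h \<omega>))"
  proof -
    have "circ_avg (\<lambda>_. 0::real) \<le> circ_avg (\<lambda>\<omega>. norm (g m) - norm (?h \<omega>))"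
    proof (rule circ_avg_mono)
      show "0 \<le> norm (g m) - norm (?h \<omega>)" if "norm \<omega> = 1" for \<omega>
        using m(2)[OF inK[OF that]] by simp
    qed (intro continuous_intros hc)+
    then show ?thesis by simp
  qed
  ultimately have "circ_avg (\<lambda>\<omega>. norm (g m) - norm (?h \<omega>)) = 0" by (rule order_antisym)
  moreover have "0 \<le> norm (g m) - norm (?h \<omega>)" if "norm \<omega> = 1" for \<omega>
    using m(2)[OF inK[OF that]] by simp
  moreover have "continuous_on (sphere 0 1) (\<lambda>\<omega>. norm (g m) - norm (?h \<omega>))"
    by (intro continuous_intros hc)
  ultimately have "norm (g m) - norm (?h 1) = 0"
    using circ_avg_eq_0_imp[of "\<lambda>\<omega>. norm (g m) - norm (?h \<omega>)" 1] norm_one by blast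
  then have "p + of_real r \<in> A" using inK[of 1] unfolding A_def by simp
  from p(2)[OF this] r show False by simp
qed

text \<open>
Multiplication by a real-linear function shifts Fourier coefficients by one in both directions, so the
functions with vanishing coefficients are closed under multiplication by real polynomials. Induction over
the polynomial therefore has to let \<open>g\<close> vary.
\<close>

lemma fourier_poly_zero:
  assumes "real_polynomial_function p"
    and "continuous_on (sphere 0 1) g" "\<And>k. circ_avg (\<lambda>\<omega>. g \<omega> * hpow k \<omega>) = 0"
  shows "circ_avg (\<lambda>\<omega>. g \<omega> * of_real (p \<omega>) * hpow k \<omega>) = 0"
  using assms
proof (induction arbitrary: g k)
  case (linear f)
  interpret bounded_linear f by fact
  define \<alpha> where "\<alpha> = (of_real (f 1) - \<i> * of_real (f \<i>)) / 2"
  define \<beta> where "\<beta> = (of_real (f 1) + \<i> * of_real (f \<i>)) / 2"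
  have f: "of_real (f w) = \<alpha> * w + \<beta> * cnj w" for w
  proof -
    have "f w = f (Re w *\<^sub>R 1 + Im w *\<^sub>R \<i>)"
      by (metis complex_eq scaleR_conv_of_real mult.right_neutral mult.commute)
    then have "f w = Re w * f 1 + Im w * f \<i>" by (simp add: add scaleR)
    then show ?thesis
      by (simp add: \<alpha>_def \<beta>_def complex_eq_iff field_simps)
  qed
  have h1: "hpow 1 w = w" "hpow (-1) w = cnj w" for w by (auto simp: hpow_def)
  have "circ_avg (\<lambda>\<omega>. g \<omega> * of_real (f \<omega>) * hpow k \<omega>) =
     circ_avg (\<lambda>\<omega>. \<alpha> * (g \<omega> * hpow (k + 1) \<omega>) + \<beta> * (g \<omega> * hpow (k + - 1) \<omega>))"
    by (rule circ_avg_cong, subst (1 2) hpow_add) (auto simp: f h1 algebra_simps)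
  also have "\<dots> = \<alpha> * circ_avg (\<lambda>\<omega>. g \<omega> * hpow (k + 1) \<omega>) + \<beta> * circ_avg (\<lambda>\<omega>. g \<omega> * hpow (k + - 1) \<omega>)"
    using linear.prems(1)
    by (simp only: circ_avg_add circ_avg_mult_left continuous_intros)
  finally show ?case using linear.prems(2) by simp
next
  case (const c)
  have "circ_avg (\<lambda>\<omega>. g \<omega> * of_real c * hpow k \<omega>) = circ_avg (\<lambda>\<omega>. of_real c * (g \<omega> * hpow k \<omega>))"
    by (simp add: mult_ac)
  also have "\<dots> = of_real c * circ_avg (\<lambda>\<omega>. g \<omega> * hpow k \<omega>)"
    by (intro circ_avg_mult_left continuous_intros const)
  finally show ?case using const by simp
next
  case (add p q)
  have c: "continuous_on (sphere 0 1) p" "continuous_on (sphere 0 1) q"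
    using add.hyps by (auto simp: continuous_on_polymonial_function real_polynomial_function_eq)
  have "circ_avg (\<lambda>\<omega>. g \<omega> * of_real (p \<omega> + q \<omega>) * hpow k \<omega>) =
     circ_avg (\<lambda>\<omega>. g \<omega> * of_real (p \<omega>) * hpow k \<omega> + g \<omega> * of_real (q \<omega>) * hpow k \<omega>)"
    by (simp add: algebra_simps)
  also have "\<dots> = 0"
    by (subst circ_avg_add; (intro continuous_intros add.prems c)?) (simp add: add)
  finally show ?case .
next
  case (mult p q)
  have c: "continuous_on (sphere 0 1) p"
    using mult.hyps by (auto simp: continuous_on_polymonial_function real_polynomial_function_eq)
  have "circ_avg (\<lambda>\<omega>. (g \<omega> * of_real (p \<omega>)) * of_real (q \<omega>) * hpow k \<omega>) = 0"
    by (intro mult.IH(2) continuous_intros c mult.prems mult.IH(1))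
  then show ?case by (simp add: mult_ac)
qed

text \<open>
Weierstrass approximation of the conjugate of \<open>g\<close> by polynomials gives vanishing mean of
\<open>(norm g)\<^sup>2\<close>.
\<close>

lemma fourier_unique:
  assumes g: "continuous_on (sphere 0 1) g" and z: "\<And>k. circ_avg (\<lambda>\<omega>. g \<omega> * hpow k \<omega>) = 0"
    and \<omega>: "norm \<omega> = 1"
  shows "g \<omega> = 0"
proof -
  have "compact (g ` sphere 0 1)" by (intro compact_continuous_image g) auto
  then obtain B where B: "\<And>\<omega>. norm \<omega> = 1 \<Longrightarrow> norm (g \<omega>) \<le> B" "B > 0"
    using compact_imp_bounded bounded_pos[of "g ` sphere 0 1"] by (metis dist_0_norm imageI mem_sphere)
  let ?I = "circ_avg (\<lambda>\<omega>. g \<omega> * cnj (g \<omega>))"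
  have "norm ?I \<le> e" if e: "e > 0" for e
  proof -
    obtain p where p: "real_polynomial_function p"
        "\<And>x. x \<in> sphere 0 1 \<Longrightarrow> \<bar>Re (g x) - p x\<bar> < e / (2 * B)"
      using Stone_Weierstrass_real_polynomial_function[of "sphere 0 1" "\<lambda>x. Re (g x)" "e / (2 * B)"] e B g
      by (auto intro!: continuous_intros)
    obtain q where q: "real_polynomial_function q"
        "\<And>x. x \<in> sphere 0 1 \<Longrightarrow> \<bar>Im (g x) - q x\<bar> < e / (2 * B)"
      using Stone_Weierstrass_real_polynomial_function[of "sphere 0 1" "\<lambda>x. Im (g x)" "e / (2 * B)"] e B g
      by (auto intro!: continuous_intros)
    have c: "continuous_on (sphere 0 1) p" "continuous_on (sphere 0 1) q"
      using p q by (auto simp: continuous_on_polymonial_function real_polynomial_function_eq)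
    have "circ_avg (\<lambda>\<omega>. g \<omega> * of_real (p \<omega>)) = 0" "circ_avg (\<lambda>\<omega>. g \<omega> * of_real (q \<omega>)) = 0"
      using fourier_poly_zero[OF p(1) g z, of 0] fourier_poly_zero[OF q(1) g z, of 0] by simp_all
    then have "circ_avg (\<lambda>\<omega>. g \<omega> * of_real (p \<omega>) - \<i> * (g \<omega> * of_real (q \<omega>))) = 0"
      by (subst circ_avg_diff circ_avg_mult_left; (intro continuous_intros g c)?)+ simp
    then have "?I = circ_avg (\<lambda>\<omega>. g \<omega> * cnj (g \<omega>) - (g \<omega> * of_real (p \<omega>) - \<i> * (g \<omega> * of_real (q \<omega>))))"
      by (subst circ_avg_diff; (intro continuous_intros g c)?) simp
    also have "norm \<dots> \<le> circ_avg (\<lambda>_. e)"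
    proof (rule norm_circ_avg_le)
      fix \<omega> :: complex assume \<omega>: "norm \<omega> = 1"
      have "g \<omega> * cnj (g \<omega>) - (g \<omega> * of_real (p \<omega>) - \<i> * (g \<omega> * of_real (q \<omega>)))
         = g \<omega> * (of_real (Re (g \<omega>) - p \<omega>) - \<i> * of_real (Im (g \<omega>) - q \<omega>))"
        by (simp add: complex_eq_iff algebra_simps)
      also have "norm \<dots> \<le> B * (e / (2 * B) + e / (2 * B))"
      proof -
        have "norm (of_real (Re (g \<omega>) - p \<omega>) - \<i> * of_real (Im (g \<omega>) - q \<omega>))
            \<le> \<bar>Re (g \<omega>) - p \<omega>\<bar> + \<bar>Im (g \<omega>) - q \<omega>\<bar>"
          by (rule order_trans[OF norm_triangle_ineq4]) (simp add: norm_mult del: of_real_diff)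
        also have "\<dots> \<le> e / (2 * B) + e / (2 * B)"
          using p(2)[of \<omega>] q(2)[of \<omega>] \<omega> by (intro add_mono) auto
        finally show ?thesis
          unfolding norm_mult using B(1)[OF \<omega>] B(2) by (intro mult_mono) auto
      qed
      also have "\<dots> = e" using B by (simp add: field_simps)
      finally show "norm (g \<omega> * cnj (g \<omega>) - (g \<omega> * of_real (p \<omega>) - \<i> * (g \<omega> * of_real (q \<omega>)))) \<le> e" .
    qed (intro continuous_intros g c)+
    finally show ?thesis by simp
  qed
  then have "?I = 0" by (metis norm_le_zero_iff field_le_epsilon add_0)
  moreover have "?I = of_real (circ_avg (\<lambda>\<omega>. (norm (g \<omega>))\<^sup>2))"
    unfolding complex_norm_square[symmetric] by (intro circ_avg_of_real continuous_intros g)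
  ultimately have "circ_avg (\<lambda>\<omega>. (norm (g \<omega>))\<^sup>2) = 0" by simp
  then have "(norm (g \<omega>))\<^sup>2 = 0"
    by (intro circ_avg_eq_0_imp[where g = "\<lambda>\<omega>. (norm (g \<omega>))\<^sup>2"]) (auto intro!: continuous_intros g \<omega>)
  then show ?thesis by simp
qed

section \<open>Functions dominated by the truncated logarithm\<close>

definition cscale :: "complex \<Rightarrow> complex \<times> complex \<Rightarrow> complex \<times> complex" where
  "cscale t z = (t * fst z, t * snd z)"

lemma norm_cscale: "norm (cscale t z) = norm t * norm z"
  by (cases z) (simp add: cscale_def norm_Pair norm_mult power_mult_distrib real_sqrt_mult
      flip: distrib_left)

lemma cscale_1 [simp]: "cscale 1 z = z" and cscale_0 [simp]: "cscale 0 z = 0"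
  by (simp_all add: cscale_def zero_prod_def)

lemma cscale_cscale: "cscale s (cscale t z) = cscale (s * t) z"
  by (simp add: cscale_def mult_ac)

lemma cscale_add: "cscale (s + t) z = cscale s z + cscale t z"
  by (simp add: cscale_def algebra_simps)

lemma continuous_on_cscale [continuous_intros]:
  "continuous_on S f \<Longrightarrow> continuous_on S g \<Longrightarrow> continuous_on S (\<lambda>x. cscale (f x) (g x))"
  unfolding cscale_def by (intro continuous_intros)

text \<open>
The extremal function itself, written with \<open>max\<close> inside the logarithm so that it is real-valued and
continuous everywhere, the origin included.
\<close>

definition trunc_log :: "complex \<times> complex \<Rightarrow> real" where
  "trunc_log z = ln (max (norm z) (exp (- 1)))"

lemma trunc_log_inner: "norm z \<le> exp (- 1) \<Longrightarrow> trunc_log z = - 1"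
  unfolding trunc_log_def by (simp add: max_def)

lemma trunc_log_outer: "exp (- 1) \<le> norm z \<Longrightarrow> trunc_log z = ln (norm z)"
  unfolding trunc_log_def by (simp add: max_def)

lemma continuous_on_trunc_log [continuous_intros]:
  "continuous_on S f \<Longrightarrow> continuous_on S (\<lambda>x. trunc_log (f x))"
  unfolding trunc_log_def by (intro continuous_intros) (auto simp: max_def)

definition mean_gap :: "(complex \<times> complex \<Rightarrow> 'a::banach) \<Rightarrow> complex \<times> complex \<Rightarrow> complex \<times> complex \<Rightarrow> 'a" where
  "mean_gap f a b = circ_avg (\<lambda>\<omega>. f (a + cscale \<omega> b)) - f a"

definition disc_in_ball :: "complex \<times> complex \<Rightarrow> complex \<times> complex \<Rightarrow> bool" where
  "disc_in_ball a b \<longleftrightarrow> (\<forall>\<omega>. norm \<omega> \<le> 1 \<longrightarrow> norm (a + cscale \<omega> b) < 1)"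

text \<open>
What remains of a decomposition \<open>u = u1 + u2\<close> once the plurisubharmonicity of the parts is spent: both
summands have nonnegative mean gap, hence the gap of each is at most that of \<open>u\<close>. In this form the condition makes sense
for complex-valued functions and survives Fourier projection, which sub-mean-value inequalities do not.
Vanishing outside the ball records the boundary values and makes every average defined without domain
conditions.
\<close>

definition dominated :: "(complex \<times> complex \<Rightarrow> complex) \<Rightarrow> bool" where
  "dominated f \<longleftrightarrow> continuous_on UNIV f \<and> (\<forall>z. 1 \<le> norm z \<longrightarrow> f z = 0) \<and>
     (\<forall>a b. disc_in_ball a b \<longrightarrow> norm (mean_gap f a b) \<le> mean_gap trunc_log a b)"

lemma dominated_cont:
  "dominated f \<Longrightarrow> continuous_on S g \<Longrightarrow> continuous_on S (\<lambda>x. f (g x))"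
  unfolding dominated_def using continuous_on_compose2 by blast

lemma dominated_outside: "dominated f \<Longrightarrow> 1 \<le> norm z \<Longrightarrow> f z = 0"
  unfolding dominated_def by blast

lemma dominated_gap:
  "dominated f \<Longrightarrow> disc_in_ball a b \<Longrightarrow> norm (mean_gap f a b) \<le> mean_gap trunc_log a b"
  unfolding dominated_def by blast

lemma dominated_cnj:
  assumes "dominated f" shows "dominated (\<lambda>z. cnj (f z))"
proof -
  have "continuous_on (sphere 0 1) (\<lambda>\<omega>. f (a + cscale \<omega> b))" for a b
    by (intro dominated_cont[OF assms] continuous_intros)
  from circ_avg_cnj[OF this] have "mean_gap (\<lambda>z. cnj (f z)) a b = cnj (mean_gap f a b)" for a b
    unfolding mean_gap_def by simp
  moreover have "continuous_on UNIV (\<lambda>z. cnj (f z))"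
    by (intro continuous_intros dominated_cont[OF assms])
  ultimately show ?thesis using assms unfolding dominated_def by auto
qed

text \<open>
The truncated logarithm depends on the norm alone.
\<close>

lemma dominated_isometry:
  assumes "dominated f" and cont: "continuous_on UNIV T" and "\<And>z. norm (T z) = norm z"
    and T: "\<And>a b \<omega>. T (a + cscale \<omega> b) = T a + cscale \<omega> (T b)"
  shows "dominated (\<lambda>z. f (T z))"
proof -
  have "mean_gap (\<lambda>z. f (T z)) a b = mean_gap f (T a) (T b)" for a b
    unfolding mean_gap_def by (simp add: T)
  moreover have "mean_gap trunc_log (T a) (T b) = mean_gap trunc_log a b" for a b
    unfolding mean_gap_def trunc_log_def by (simp add: T[symmetric] assms(3))
  moreover have "disc_in_ball (T a) (T b) = disc_in_ball a b" for a b
    unfolding disc_in_ball_def by (simp add: T[symmetric] assms(3))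
  moreover have "continuous_on UNIV (\<lambda>z. f (T z))"
    by (intro dominated_cont[OF assms(1)] cont)
  ultimately show ?thesis using assms unfolding dominated_def by metis
qed

lemma norm_prod_swap [simp]: "norm (prod.swap z) = norm (z :: complex \<times> complex)"
  by (cases z) (simp add: norm_Pair add.commute)

lemma dominated_swap: "dominated f \<Longrightarrow> dominated (\<lambda>z. f (prod.swap z))"
  by (rule dominated_isometry) (auto simp: cscale_def prod.swap_def norm_Pair add.commute intro!: continuous_intros)

definition rot :: "complex \<Rightarrow> complex \<times> complex \<Rightarrow> complex \<times> complex" where
  "rot \<eta> z = (\<eta> * fst z, snd z)"

lemma norm_rot: "norm \<eta> = 1 \<Longrightarrow> norm (rot \<eta> z) = norm z"
  by (cases z) (simp add: rot_def norm_Pair norm_mult)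

lemma rot_rot: "rot \<eta> (rot \<xi> z) = rot (\<eta> * \<xi>) z"
  by (simp add: rot_def mult.assoc)

lemma rot_1 [simp]: "rot 1 z = z"
  by (simp add: rot_def)

lemma rot_disc: "rot \<eta> (a + cscale \<omega> b) = rot \<eta> a + cscale \<omega> (rot \<eta> b)"
  by (simp add: rot_def cscale_def algebra_simps)

lemma continuous_on_rot [continuous_intros]:
  "continuous_on S f \<Longrightarrow> continuous_on S g \<Longrightarrow> continuous_on S (\<lambda>x. rot (f x) (g x))"
  unfolding rot_def by (intro continuous_intros)

text \<open>
Fourier component with respect to rotation of the first coordinate. Components for the second coordinate
are obtained by exchanging the coordinates.
\<close>

definition fourier :: "int \<Rightarrow> (complex \<times> complex \<Rightarrow> complex) \<Rightarrow> complex \<times> complex \<Rightarrow> complex" where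
  "fourier k f z = circ_avg (\<lambda>\<eta>. f (rot \<eta> z) * hpow (- k) \<eta>)"

lemma fourier_rot:
  assumes "dominated f" "norm \<eta> = 1"
  shows "fourier k f (rot \<eta> z) = hpow k \<eta> * fourier k f z"
proof -
  have "fourier k f z = circ_avg (\<lambda>\<xi>. f (rot (\<eta> * \<xi>) z) * hpow (- k) (\<eta> * \<xi>))"
    unfolding fourier_def
    by (rule circ_avg_rotate[symmetric]) (intro continuous_intros dominated_cont[OF assms(1)] assms)+
  also have "\<dots> = circ_avg (\<lambda>\<xi>. hpow (- k) \<eta> * (f (rot \<xi> (rot \<eta> z)) * hpow (- k) \<xi>))"
    by (simp add: hpow_mult rot_rot mult_ac)
  also have "\<dots> = hpow (- k) \<eta> * fourier k f (rot \<eta> z)"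
    unfolding fourier_def by (intro circ_avg_mult_left continuous_intros dominated_cont[OF assms(1)])
  finally show ?thesis using hpow_minus_cancel[OF assms(2), of k] by (simp flip: mult.assoc)
qed

text \<open>
The gap of the component is the average of the gaps over rotated discs, with unimodular weights, and the
gap of \<open>trunc_log\<close> is the same for all these discs.
\<close>

lemma dominated_fourier:
  assumes f: "dominated f"
  shows "dominated (fourier k f)"
proof -
  have c1: "continuous_on UNIV (fourier k f)"
    unfolding fourier_def[abs_def]
    by (rule continuous_on_circ_avg)
       (auto simp: case_prod_unfold intro!: continuous_intros dominated_cont[OF f])
  have "norm (mean_gap (fourier k f) a b) \<le> mean_gap trunc_log a b" if "disc_in_ball a b" for a b
  proof -
    let ?G = "\<lambda>\<eta>. mean_gap f (rot \<eta> a) (rot \<eta> b) * hpow (- k) \<eta>"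
    have contA: "continuous_on (sphere 0 1) (\<lambda>\<eta>. circ_avg (\<lambda>\<omega>. f (rot \<eta> a + cscale \<omega> (rot \<eta> b))))"
      by (rule continuous_on_circ_avg)
         (auto simp: case_prod_unfold intro!: continuous_intros dominated_cont[OF f])
    have "circ_avg (\<lambda>\<omega>. fourier k f (a + cscale \<omega> b)) =
        circ_avg (\<lambda>\<eta>. circ_avg (\<lambda>\<omega>. f (rot \<eta> (a + cscale \<omega> b)) * hpow (- k) \<eta>))"
      unfolding fourier_def
      by (rule circ_avg_swap)
         (auto simp: case_prod_unfold intro!: continuous_intros dominated_cont[OF f])
    also have "\<dots> = circ_avg (\<lambda>\<eta>. circ_avg (\<lambda>\<omega>. f (rot \<eta> a + cscale \<omega> (rot \<eta> b))) * hpow (- k) \<eta>)"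
      unfolding rot_disc
      by (subst circ_avg_mult_right) (auto intro!: continuous_intros dominated_cont[OF f])
    finally have "mean_gap (fourier k f) a b = circ_avg ?G"
      unfolding mean_gap_def fourier_def left_diff_distrib
      by (subst circ_avg_diff) (auto intro!: continuous_intros dominated_cont[OF f] contA)
    also have "norm \<dots> \<le> circ_avg (\<lambda>_. mean_gap trunc_log a b)"
    proof (rule norm_circ_avg_le)
      show "continuous_on (sphere 0 1) ?G"
        unfolding mean_gap_def by (intro continuous_intros contA dominated_cont[OF f])
      fix \<eta> :: complex assume \<eta>: "norm \<eta> = 1"
      have "disc_in_ball (rot \<eta> a) (rot \<eta> b)"
        using that norm_rot[OF \<eta>] unfolding disc_in_ball_def rot_disc[symmetric] by simp
      then have "norm (mean_gap f (rot \<eta> a) (rot \<eta> b)) \<le> mean_gap trunc_log (rot \<eta> a) (rot \<eta> b)"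
        by (rule dominated_gap[OF f])
      also have "\<dots> = mean_gap trunc_log a b"
        unfolding mean_gap_def rot_disc[symmetric] trunc_log_def norm_rot[OF \<eta>] ..
      finally show "norm (?G \<eta>) \<le> mean_gap trunc_log a b"
        by (simp add: norm_mult norm_hpow \<eta>)
    qed (intro continuous_intros)
    finally show ?thesis by simp
  qed
  moreover have "fourier k f z = 0" if "1 \<le> norm z" for z
  proof -
    have "fourier k f z = circ_avg (\<lambda>_. 0)"
      unfolding fourier_def
      using that norm_rot[of _ z] by (intro circ_avg_cong) (simp add: dominated_outside[OF f])
    then show ?thesis by simp
  qed
  ultimately show ?thesis using c1 unfolding dominated_def by blast
qed

text \<open>
Where \<open>trunc_log\<close> is constant its gap vanishes, so \<open>f\<close> is harmonic on the disc; on the boundary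
circle it has the values of a harmonic monomial.
\<close>

lemma dominated_inner_homogeneous:
  assumes f: "dominated f"
    and disc: "\<And>t. norm t \<le> 1 \<Longrightarrow> norm (p + cscale t q) \<le> exp (- 1)"
    and char: "\<And>\<eta>. norm \<eta> = 1 \<Longrightarrow> f (p + cscale \<eta> q) = hpow k \<eta> * f (p + q)"
    and t: "norm t \<le> 1"
  shows "f (p + cscale t q) = hpow k t * f (p + q)"
proof -
  let ?g = "\<lambda>t. f (p + cscale t q)" and ?h = "\<lambda>t. f (p + q) * hpow k t"
  have "mean_valued_on (ball 0 1) ?g"
    unfolding mean_valued_on_def
  proof (intro allI impI, elim conjE)
    fix c :: complex and r :: real assume r: "0 < r" "cball c r \<subseteq> ball 0 1"
    define a where "a = p + cscale c q"
    define b where "b = cscale (of_real r) q"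
    have ab: "a + cscale \<omega> b = p + cscale (c + \<omega> * of_real r) q" for \<omega>
      by (simp add: a_def b_def cscale_cscale cscale_add)
    have small: "norm (a + cscale \<omega> b) \<le> exp (- 1)" if "norm \<omega> \<le> 1" for \<omega>
      unfolding ab using affine_in_cball[OF that, of r c] r by (intro disc) fastforce
    have "exp (- 1) < (1::real)" by simp
    then have "disc_in_ball a b" unfolding disc_in_ball_def using small le_less_trans by blast
    then have "norm (mean_gap f a b) \<le> mean_gap trunc_log a b"
      by (rule dominated_gap[OF f])
    also have "\<dots> = circ_avg (\<lambda>_. - 1) - (- 1 :: real)"
      unfolding mean_gap_def using small[of 0] small
      by (intro arg_cong2[of _ _ _ _ "(-)"] circ_avg_cong) (auto intro!: trunc_log_inner)
    finally have "mean_gap f a b = 0" by simp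
    then show "circ_avg (\<lambda>\<omega>. ?g (c + \<omega> * of_real r)) = ?g c"
      unfolding mean_gap_def ab by (simp add: a_def)
  qed
  then have "mean_valued_on (ball 0 1) (\<lambda>t. ?g t - ?h t)"
    by (intro mean_valued_diff mean_valued_cmult mean_valued_hpow continuous_intros dominated_cont[OF f])
  then have "?g t - ?h t = 0"
  proof (rule maximum_principle[rotated 4])
    show "?g z - ?h z = 0" if "z \<in> cball 0 1 - ball 0 1" for z
      using that char[of z] by simp
    show "continuous_on (cball 0 1) (\<lambda>t. ?g t - ?h t)"
      by (intro continuous_intros dominated_cont[OF f])
  qed (use t in auto)
  then show ?thesis by simp
qed

text \<open>
On a complex line through the origin \<open>trunc_log\<close> is harmonic between the two spheres, hence so is
\<open>f\<close>, and it is determined by its values on the inner circle.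
\<close>

lemma dominated_radial:
  assumes f: "dominated f" and \<zeta>: "norm \<zeta> = 1"
    and h: "continuous_on {t. exp (- 1) \<le> norm t \<and> norm t \<le> 1} h"
      "mean_valued_on {t. exp (- 1) < norm t \<and> norm t < 1} h"
      "\<And>t. norm t = exp (- 1) \<Longrightarrow> h t = f (cscale t \<zeta>)"
      "\<And>t. norm t = 1 \<Longrightarrow> h t = 0"
    and t: "exp (- 1) \<le> norm t" "norm t \<le> 1"
  shows "f (cscale t \<zeta>) = h t"
proof -
  let ?S = "{t::complex. exp (- 1) < norm t \<and> norm t < 1}"
  let ?K = "{t::complex. exp (- 1) \<le> norm t \<and> norm t \<le> 1}"
  let ?g = "\<lambda>t. f (cscale t \<zeta>)"
  have "mean_valued_on ?S ?g"
    unfolding mean_valued_on_def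
  proof (intro allI impI, elim conjE)
    fix c :: complex and r :: real assume r: "0 < r" "cball c r \<subseteq> ?S"
    define a where "a = cscale c \<zeta>"
    define b where "b = cscale (of_real r) \<zeta>"
    have ab: "a + cscale \<omega> b = cscale (c + \<omega> * of_real r) \<zeta>" for \<omega>
      by (simp add: a_def b_def cscale_cscale cscale_add)
    have inS: "c + \<omega> * of_real r \<in> ?S" if "norm \<omega> \<le> 1" for \<omega>
      using affine_in_cball[OF that, of r c] r by fastforce
    have c: "c \<in> ?S" using inS[of 0] by simp
    have "disc_in_ball a b" unfolding disc_in_ball_def ab using inS \<zeta> by (simp add: norm_cscale)
    then have "norm (mean_gap f a b) \<le> mean_gap trunc_log a b"
      by (rule dominated_gap[OF f])
    also have "\<dots> = circ_avg (\<lambda>\<omega>. ln (norm (c + \<omega> * of_real r))) - ln (norm c)"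
      unfolding mean_gap_def ab using inS c \<zeta>
      by (intro arg_cong2[of _ _ _ _ "(-)"] circ_avg_cong)
         (simp_all add: trunc_log_outer norm_cscale a_def less_imp_le)
    also have "\<dots> = 0"
    proof -
      have "0 \<notin> ?S" using exp_gt_zero[of "-1::real"] by simp
      then have "0 \<notin> cball c r" using r by blast
      then show ?thesis using r by (simp add: circ_avg_ln_norm)
    qed
    finally have "mean_gap f a b = 0" by simp
    then show "circ_avg (\<lambda>\<omega>. ?g (c + \<omega> * of_real r)) = ?g c"
      unfolding mean_gap_def ab by (simp add: a_def)
  qed
  moreover have cg: "continuous_on T ?g" for T by (intro continuous_intros dominated_cont[OF f])
  moreover have "continuous_on ?S h" by (rule continuous_on_subset[OF h(1)]) auto
  ultimately have mv: "mean_valued_on ?S (\<lambda>t. ?g t - h t)"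
    by (intro mean_valued_diff h)
  have "?g t - h t = 0"
  proof (rule maximum_principle[OF _ _ _ _ mv])
    have "?K = cball 0 1 \<inter> norm -` {exp (- 1)..}" by auto
    also have "compact \<dots>"
      by (intro compact_Int_closed closed_vimage continuous_intros) auto
    finally show "compact ?K" .
    show "open ?S" by (intro open_Collect_conj open_Collect_less continuous_intros)
    show "continuous_on ?K (\<lambda>t. ?g t - h t)" by (intro continuous_intros h cg)
    show "?g z - h z = 0" if "z \<in> ?K - ?S" for z
    proof -
      have "norm z = exp (- 1) \<or> norm z = 1" using that by auto
      moreover have "?g z = 0" if "norm z = 1"
        using that \<zeta> by (simp add: dominated_outside[OF f] norm_cscale)
      ultimately show ?thesis using h by auto
    qed
  qed (use t in auto)
  then show ?thesis by simp
qed

section \<open>Tangential displacement of radial discs\<close>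

lemma circ_avg_has_vector_derivative:
  fixes h :: "real \<Rightarrow> complex \<Rightarrow> complex"
  assumes "\<And>x \<omega>. x \<in> U \<Longrightarrow> norm \<omega> = 1 \<Longrightarrow> ((\<lambda>x. h x \<omega>) has_vector_derivative h' x \<omega>) (at x within U)"
    and "\<And>x. x \<in> U \<Longrightarrow> continuous_on (sphere 0 1) (h x)"
    and "continuous_on (U \<times> sphere 0 1) (\<lambda>(x, \<omega>). h' x \<omega>)"
    and "x0 \<in> U" "convex U"
  shows "((\<lambda>x. circ_avg (h x)) has_vector_derivative circ_avg (h' x0)) (at x0 within U)"
proof -
  have c: "continuous_on (U \<times> cbox 0 (2 * pi)) (\<lambda>(x, t). h' x (cis t))"
    unfolding case_prod_unfold
    by (rule continuous_on_compose2[OF assms(3)[unfolded case_prod_unfold],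
          of _ "\<lambda>p. (fst p, cis (snd p))", simplified]) (auto intro!: continuous_intros)
  have "((\<lambda>x. integral (cbox 0 (2 * pi)) (\<lambda>t. h x (cis t))) has_vector_derivative
      integral (cbox 0 (2 * pi)) (\<lambda>t. h' x0 (cis t))) (at x0 within U)"
    by (rule leibniz_rule_vector_derivative[OF _ _ c])
       (use assms cis_integrable[OF assms(2)] in auto)
  from bounded_linear.has_vector_derivative[OF bounded_linear_scaleR_right this]
  show ?thesis unfolding circ_avg_def by simp
qed

text \<open>
This is how positivity is exploited: the gap of \<open>trunc_log\<close> is of second order in the displacement
\<open>e\<close> of a disc, so the first-order term of the gap of \<open>f\<close> has to vanish.
\<close>

lemma quadratic_bound_imp_derivative_0:
  fixes \<psi> :: "real \<Rightarrow> complex"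
  assumes d: "0 < d" and der: "(\<psi> has_vector_derivative L) (at 0 within {-d..d})"
    and bd: "\<And>e. \<bar>e\<bar> \<le> d \<Longrightarrow> norm (\<psi> e) \<le> K * e\<^sup>2"
  shows "L = 0"
proof -
  have "at 0 within {-d..d} = at (0::real)"
    using d by (intro at_within_interior) simp
  then have der': "(\<psi> has_vector_derivative L) (at 0)" using der by simp
  have \<psi>0: "\<psi> 0 = 0" using bd[of 0] d by simp
  have "((\<lambda>e. norm (\<psi> e - \<psi> 0 - e *\<^sub>R 0) / norm e) \<longlongrightarrow> 0) (at 0)"
  proof (rule tendsto_sandwich[of "\<lambda>_. 0"])
    show "\<forall>\<^sub>F e in at 0. norm (\<psi> e - \<psi> 0 - e *\<^sub>R 0) / norm e \<le> K * \<bar>e\<bar>"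
    proof -
      have "\<forall>\<^sub>F e in at (0::real). \<bar>e\<bar> < d"
        using d unfolding eventually_at by (auto intro!: exI[of _ d] simp: dist_real_def)
      moreover have "\<forall>\<^sub>F e in at (0::real). e \<noteq> 0" by (simp add: eventually_at_filter)
      ultimately show ?thesis
      proof eventually_elim
        case (elim e)
        have "norm (\<psi> e) \<le> K * \<bar>e\<bar> * \<bar>e\<bar>" using bd[of e] elim by (simp add: power2_eq_square)
        then show ?case using elim \<psi>0 by (simp add: divide_le_eq)
      qed
    qed
    have "((\<lambda>e. K * \<bar>e\<bar>) \<longlongrightarrow> K * \<bar>0\<bar>) (at (0::real))" by (intro tendsto_intros)
    then show "((\<lambda>e. K * \<bar>e\<bar>) \<longlongrightarrow> 0) (at (0::real))" by simp
  qed auto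
  then have "(\<psi> has_vector_derivative 0) (at 0)"
    unfolding has_vector_derivative_def has_derivative_at
    by (simp add: bounded_linear_zero)
  from vector_derivative_unique_at[OF der' this] show ?thesis .
qed

text \<open>
For \<open>k > 0\<close> the function \<open>1 / (t * cnj t ^ k)\<close> is not harmonic: its average differs from its value
\<open>1 / c ^ (k + 1)\<close> at the centre. On the circle \<open>cnj \<omega> = 1 / \<omega>\<close>, so the conjugate integrand is a Cauchy
kernel with pole at \<open>- r / c\<close>.
\<close>

lemma circ_avg_mixed_power:
  fixes c r :: real
  assumes r: "0 < r" "r < c"
  shows "circ_avg (\<lambda>\<omega>. 1 / ((c + \<omega> * r) * cnj (c + \<omega> * r) ^ k)) = 1 / (c * (c - r\<^sup>2 / c) ^ k)"
proof -
  define F where "F = (\<lambda>\<omega>::complex. 1 / (c * (c + \<omega> * r) ^ k))"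
  have nz: "c + \<omega> * r \<noteq> 0" if "\<omega> \<in> ball 0 (c / r)" for \<omega> :: complex
  proof
    assume "c + \<omega> * r = 0"
    then have "norm (\<omega> * r) = norm (complex_of_real c)" by (metis add_eq_0_iff norm_minus_cancel)
    then show False using that r by (simp add: norm_mult field_simps)
  qed
  have w: "norm (- complex_of_real r / c) < 1" using r by (simp add: norm_divide)
  have "circ_avg (\<lambda>\<omega>. F \<omega> * \<omega> / (\<omega> - - complex_of_real r / c)) = F (- complex_of_real r / c)"
  proof (rule circ_avg_Cauchy[OF _ _ _ w])
    show "F holomorphic_on ball 0 (c / r)"
      unfolding F_def using nz r by (intro holomorphic_intros) auto
    show "cball 0 1 \<subseteq> ball (0::complex) (c / r)"
    proof
      fix z :: complex assume "z \<in> cball 0 1"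
      then have "norm z \<le> 1" by simp
      also have "1 < c / r" using r by simp
      finally show "z \<in> ball 0 (c / r)" by simp
    qed
  qed auto
  moreover have "F \<omega> * \<omega> / (\<omega> - - complex_of_real r / c) = cnj (1 / ((c + \<omega> * r) * cnj (c + \<omega> * r) ^ k))"
    if \<omega>: "norm \<omega> = 1" for \<omega> :: complex
  proof -
    have \<omega>': "\<omega> * cnj \<omega> = 1" using \<omega> by (simp add: complex_mult_cnj cmod_def)
    have z: "c + \<omega> * r \<noteq> 0" using nz[of \<omega>] \<omega> r by simp
    have "F \<omega> * \<omega> / (\<omega> - - complex_of_real r / c)
        = \<omega> / ((c + \<omega> * r) ^ k * (c * (\<omega> - - complex_of_real r / c)))"
      unfolding F_def by simp
    also have "c * (\<omega> - - complex_of_real r / c) = \<omega> * cnj (c + \<omega> * r)"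
      using \<omega>' r by (simp add: algebra_simps)
    also have "\<omega> / ((c + \<omega> * r) ^ k * (\<omega> * cnj (c + \<omega> * r)))
        = 1 / ((c + \<omega> * r) ^ k * cnj (c + \<omega> * r))"
      using \<omega> by auto
    finally show ?thesis by (simp add: mult.commute)
  qed
  ultimately have "circ_avg (\<lambda>\<omega>. cnj (1 / ((c + \<omega> * r) * cnj (c + \<omega> * r) ^ k))) = F (- complex_of_real r / c)"
    by (metis (no_types, lifting) circ_avg_cong)
  moreover have "continuous_on (sphere 0 1) (\<lambda>\<omega>::complex. 1 / ((c + \<omega> * r) * cnj (c + \<omega> * r) ^ k))"
    using nz r by (intro continuous_intros) auto
  ultimately have "cnj (circ_avg (\<lambda>\<omega>. 1 / ((c + \<omega> * r) * cnj (c + \<omega> * r) ^ k))) = F (- complex_of_real r / c)"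
    by (simp only: circ_avg_cnj)
  then have "circ_avg (\<lambda>\<omega>. 1 / ((c + \<omega> * r) * cnj (c + \<omega> * r) ^ k)) = cnj (F (- complex_of_real r / c))"
    by (metis complex_cnj_cnj)
  then show ?thesis unfolding F_def by (simp add: power2_eq_square)
qed

lemma recip_power: "t \<noteq> 0 \<Longrightarrow> t ^ k - cnj (1 / t ^ k) = t ^ k * (1 - 1 / of_real (norm t ^ (2 * k)))"
proof -
  assume "t \<noteq> 0"
  moreover have "of_real (norm t ^ (2 * k)) = (of_real ((norm t)\<^sup>2) :: complex) ^ k"
    by (simp add: power_mult)
  then have "of_real (norm t ^ (2 * k)) = t ^ k * cnj t ^ k"
    by (simp only: complex_norm_square power_mult_distrib)
  ultimately show ?thesis by (simp add: field_simps)
qed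

lemma exp_minus_one_le: "exp (- 1) \<le> (1 / 2 :: real)"
  using exp_ge_add_one_self[of 1] by (simp add: exp_minus field_simps)

text \<open>
The vectors \<open>(x, y)\<close> and \<open>(- y, x)\<close> are orthonormal.
\<close>

lemma norm_displaced:
  fixes t :: complex and x y e :: real
  assumes "x\<^sup>2 + y\<^sup>2 = 1"
  shows "norm (t * x - e * y, t * y + e * x) = sqrt ((norm t)\<^sup>2 + e\<^sup>2)"
proof -
  have "(norm (t * x - e * y))\<^sup>2 + (norm (t * y + e * x))\<^sup>2
      = ((Re t)\<^sup>2 + (Im t)\<^sup>2 + e\<^sup>2) * (x\<^sup>2 + y\<^sup>2)"
    unfolding cmod_power2 by (simp add: power2_eq_square algebra_simps)
  then show ?thesis using assms by (simp add: norm_Pair cmod_power2)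
qed

text \<open>
Take the disc \<open>t (x, y) + e (- y, x)\<close> with \<open>t = c + \<omega> r\<close>, radial for \<open>e = 0\<close> and displaced by the
tangential vector \<open>e (- y, x)\<close>. The holomorphic part of \<open>f\<close> has no gap. The remaining part
\<open>Q = P / (norm z) ^ (2 k)\<close>, where \<open>P\<close> is the monomial, has first-order term
\<open>X / (t * cnj t ^ k)\<close> in \<open>e\<close>, where \<open>X\<close> is the derivative of \<open>P\<close> at \<open>(x, y)\<close> in the tangential
direction. This term is not harmonic in \<open>t\<close>, whereas the gap of \<open>trunc_log\<close> is at most
\<open>2 * e\<^sup>2\<close>.
\<close>

lemma monomial_coefficient_zero:
  assumes f: "dominated f" and M: "0 < M"
    and eq: "\<And>z. exp (- 1) \<le> norm z \<Longrightarrow> norm z \<le> 1 \<Longrightarrow>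
        f z = D * (fst z ^ M * snd z ^ N) * (1 - 1 / of_real (norm z ^ (2 * (M + N))))"
  shows "D = 0"
proof (rule ccontr)
  assume D: "D \<noteq> 0"
  define k where "k = M + N"
  have k: "k > 0" using M by (simp add: k_def)
  \<comment> \<open>The last condition says that the tangential derivative of the monomial at \<open>(x, y)\<close> is not zero.\<close>
  obtain x y :: real where xy: "x > 0" "y > 0" "x\<^sup>2 + y\<^sup>2 = 1" "N * x\<^sup>2 \<noteq> M * y\<^sup>2"
  proof (cases "real N * (3/5)\<^sup>2 = M * (4/5)\<^sup>2")
    case True
    then have "real N * (4/5)\<^sup>2 \<noteq> M * (3/5)\<^sup>2" using M by (simp add: power2_eq_square)
    then show ?thesis using that[of "4/5" "3/5"] by (simp add: power2_eq_square)
  next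
    case False
    then show ?thesis using that[of "3/5" "4/5"] by (simp add: power2_eq_square)
  qed
  \<comment> \<open>Chosen so that \<open>1/2 \<le> norm t \<le> 9/10\<close> on the disc: for small \<open>e\<close> it stays in the shell between radii \<open>exp (- 1)\<close> and 1.\<close>
  define c :: real where "c = 7/10"
  define r :: real where "r = 1/5"
  define T where "T = (\<lambda>\<omega>::complex. c + \<omega> * r)"
  have T: "1/2 \<le> norm (T \<omega>)" "norm (T \<omega>) \<le> 9/10" if "norm \<omega> \<le> 1" for \<omega>
  proof -
    have "norm (\<omega> * r) \<le> 1/5" using that by (simp add: norm_mult r_def)
    then show "1/2 \<le> norm (T \<omega>)" "norm (T \<omega>) \<le> 9/10"
      using norm_triangle_ineq[of "of_real c" "\<omega> * r"] norm_diff_ineq[of "of_real c" "\<omega> * r"]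
      by (auto simp: T_def c_def)
  qed
  have T0: "T 0 = c" by (simp add: T_def)
  have contT [continuous_intros]: "continuous_on S g \<Longrightarrow> continuous_on S (\<lambda>x. T (g x))"
    for S :: "'s::topological_space set" and g unfolding T_def by (intro continuous_intros)
  define P where "P = (\<lambda>(e::complex) (t::complex). (t * x - e * y) ^ M * (t * y + e * x) ^ N)"
  define R where "R = (\<lambda>(e::complex) t::complex. of_real ((norm t)\<^sup>2) + e\<^sup>2)"
  define Q where "Q = (\<lambda>e t. P e t / R e t ^ k)"
  define P' where "P' = (\<lambda>(e::complex) (t::complex).
      of_nat M * (t * x - e * y) ^ (M - 1) * (- y) * (t * y + e * x) ^ N
      + (t * x - e * y) ^ M * (of_nat N * (t * y + e * x) ^ (N - 1) * x))"
  define Q' where "Q' = (\<lambda>e t. (P' e t * R e t ^ k - P e t * (of_nat k * R e t ^ (k - 1) * (2 * e))) / (R e t ^ k * R e t ^ k))"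
  have R: "R (of_real e) t \<noteq> 0" if "1/2 \<le> norm t" for e :: real and t
  proof -
    have "R (of_real e) t = of_real ((norm t)\<^sup>2 + e\<^sup>2)" by (simp add: R_def)
    moreover have "(norm t)\<^sup>2 + e\<^sup>2 > 0" using that by (intro add_pos_nonneg) auto
    ultimately show ?thesis by (metis less_irrefl of_real_eq_0_iff)
  qed
  have derP: "((\<lambda>e. P e t) has_field_derivative P' e t) (at e)" for e t
    unfolding P_def P'_def by (auto intro!: derivative_eq_intros simp: algebra_simps)
  have derQ: "((\<lambda>e. Q e t) has_field_derivative Q' (of_real e) t) (at (of_real e))"
    if "1/2 \<le> norm t" for e :: real and t
  proof -
    have "((\<lambda>e. R e t ^ k) has_field_derivative of_nat k * R (of_real e) t ^ (k - 1) * (2 * of_real e)) (at (of_real e))"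
      unfolding R_def by (auto intro!: derivative_eq_intros)
    then show ?thesis unfolding Q_def Q'_def
      using R[OF that] by (intro DERIV_divide derP) auto
  qed
  have contQ: "continuous_on (sphere 0 1) (\<lambda>\<omega>. Q (of_real e) (T \<omega>))" for e :: real
    unfolding Q_def using R[OF T(1)] unfolding P_def R_def by (intro continuous_intros) auto
  define \<psi> where "\<psi> = (\<lambda>e::real. circ_avg (\<lambda>\<omega>. Q (of_real e) (T \<omega>)) - Q (of_real e) c)"
  define L where "L = circ_avg (\<lambda>\<omega>. Q' 0 (T \<omega>)) - Q' 0 c"
  have der: "(\<psi> has_vector_derivative L) (at 0 within {-(1/10)..1/10})"
    unfolding \<psi>_def L_def
  proof (rule has_vector_derivative_diff)
    have "((\<lambda>e. circ_avg (\<lambda>\<omega>. Q (of_real e) (T \<omega>))) has_vector_derivative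
        circ_avg (\<lambda>\<omega>. Q' (of_real 0) (T \<omega>))) (at 0 within {-(1/10)..1/10})"
    proof (rule circ_avg_has_vector_derivative)
      fix e :: real and \<omega> :: complex assume "norm \<omega> = 1"
      then have "1/2 \<le> norm (T \<omega>)" using T by simp
      from has_vector_derivative_real_field[OF derQ[OF this]]
      show "((\<lambda>e. Q (of_real e) (T \<omega>)) has_vector_derivative Q' (of_real e) (T \<omega>)) (at e within {-(1/10)..1/10})" .
    next
      show "continuous_on ({- (1 / 10)..1 / 10} \<times> sphere 0 1) (\<lambda>(e, \<omega>). Q' (of_real e) (T \<omega>))"
        unfolding Q'_def case_prod_unfold using R[OF T(1)] unfolding P_def P'_def R_def
        by (intro continuous_intros) auto
    qed (auto intro: contQ)
    then show "((\<lambda>e. circ_avg (\<lambda>\<omega>. Q (of_real e) (T \<omega>))) has_vector_derivative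
        circ_avg (\<lambda>\<omega>. Q' 0 (T \<omega>))) (at 0 within {-(1/10)..1/10})" by simp
    have "1/2 \<le> norm (complex_of_real c)" by (simp add: c_def)
    from has_vector_derivative_real_field[OF derQ[OF this, of 0]]
    show "((\<lambda>e. Q (of_real e) c) has_vector_derivative Q' 0 c) (at 0 within {-(1/10)..1/10})" by simp
  qed
  have bound: "norm (\<psi> e) \<le> (2 / norm D) * e\<^sup>2" if e: "\<bar>e\<bar> \<le> 1/10" for e
  proof -
    define a where "a = (of_real (c * x - e * y) :: complex, of_real (c * y + e * x) :: complex)"
    define b where "b = (of_real (r * x) :: complex, of_real (r * y) :: complex)"
    have ab: "a + cscale \<omega> b = (T \<omega> * x - e * y, T \<omega> * y + e * x)" for \<omega>
      by (simp add: a_def b_def cscale_def T_def algebra_simps)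
    have nab: "norm (a + cscale \<omega> b) = sqrt ((norm (T \<omega>))\<^sup>2 + e\<^sup>2)" for \<omega>
      unfolding ab by (rule norm_displaced[OF xy(3)])
    have e2: "e\<^sup>2 \<le> 1/100" using power_mono[OF e, of 2] by (simp add: power2_eq_square)
    have up: "norm (a + cscale \<omega> b) < 1" if "norm \<omega> \<le> 1" for \<omega>
    proof -
      have "(norm (T \<omega>))\<^sup>2 \<le> (9/10)\<^sup>2" using T(2)[OF that] by (intro power_mono) auto
      then show ?thesis unfolding nab using e2 by (simp add: power2_eq_square)
    qed
    have lo: "exp (- 1) \<le> norm (a + cscale \<omega> b)" if "norm \<omega> \<le> 1" for \<omega>
    proof -
      have "norm (T \<omega>) \<le> sqrt ((norm (T \<omega>))\<^sup>2 + e\<^sup>2)" by (rule real_le_rsqrt) simp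
      then show ?thesis unfolding nab using T(1)[OF that] exp_minus_one_le by linarith
    qed
    have fab: "f (a + cscale \<omega> b) = D * P e (T \<omega>) - D * Q e (T \<omega>)" if "norm \<omega> \<le> 1" for \<omega>
    proof -
      have "norm (a + cscale \<omega> b) ^ (2 * (M + N)) = ((norm (T \<omega>))\<^sup>2 + e\<^sup>2) ^ k"
        unfolding nab power_mult k_def by simp
      then have "f (a + cscale \<omega> b) = D * P e (T \<omega>) * (1 - 1 / of_real (((norm (T \<omega>))\<^sup>2 + e\<^sup>2) ^ k))"
        using eq[OF lo[OF that] less_imp_le[OF up[OF that]]] by (simp add: ab P_def)
      then show ?thesis by (simp add: Q_def R_def field_simps)
    qed
    have "(\<lambda>t. P e t) holomorphic_on UNIV" unfolding P_def by (intro holomorphic_intros)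
    then have avgP: "circ_avg (\<lambda>\<omega>. P e (T \<omega>)) = P e c"
      unfolding T_def by (rule circ_avg_holomorphic) auto
    have contP: "continuous_on (sphere 0 1) (\<lambda>\<omega>. P e (T \<omega>))"
      unfolding P_def by (intro continuous_intros)
    have "mean_gap f a b = circ_avg (\<lambda>\<omega>. D * P e (T \<omega>) - D * Q e (T \<omega>)) - (D * P e c - D * Q e c)"
      unfolding mean_gap_def using fab[of 0] fab by (simp add: T0 cong: circ_avg_cong)
    also have "circ_avg (\<lambda>\<omega>. D * P e (T \<omega>) - D * Q e (T \<omega>)) = D * P e c - D * circ_avg (\<lambda>\<omega>. Q e (T \<omega>))"
      using contP contQ[of e] avgP
      by (simp add: circ_avg_diff continuous_on_mult_left circ_avg_mult_left)
    finally have gap: "mean_gap f a b = - D * \<psi> e" by (simp add: \<psi>_def algebra_simps)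
    have ln_le: "trunc_log (a + cscale \<omega> b) \<le> ln (norm (T \<omega>)) + 2 * e\<^sup>2" if "norm \<omega> \<le> 1" for \<omega>
    proof -
      have t: "1/2 \<le> norm (T \<omega>)" by (rule T[OF that])
      then have tpos: "norm (T \<omega>) > 0" by linarith
      have t2: "1/4 \<le> (norm (T \<omega>))\<^sup>2" using power_mono[OF t, of 2] by (simp add: power2_eq_square)
      have "trunc_log (a + cscale \<omega> b) = ln ((norm (T \<omega>))\<^sup>2 + e\<^sup>2) / 2"
        using lo[OF that] t2 by (simp add: trunc_log_outer nab ln_sqrt add_pos_nonneg)
      also have "(norm (T \<omega>))\<^sup>2 + e\<^sup>2 = (norm (T \<omega>))\<^sup>2 * (1 + e\<^sup>2 / (norm (T \<omega>))\<^sup>2)"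
        using tpos by (simp add: field_simps)
      also have "ln \<dots> = 2 * ln (norm (T \<omega>)) + ln (1 + e\<^sup>2 / (norm (T \<omega>))\<^sup>2)"
      proof -
        have "0 < 1 + e\<^sup>2 / (norm (T \<omega>))\<^sup>2" by (intro add_pos_nonneg) auto
        moreover have "0 < (norm (T \<omega>))\<^sup>2" using tpos by simp
        ultimately show ?thesis using tpos by (simp add: ln_mult_pos ln_realpow)
      qed
      also have "ln (1 + e\<^sup>2 / (norm (T \<omega>))\<^sup>2) \<le> e\<^sup>2 / (norm (T \<omega>))\<^sup>2"
        by (rule ln_add_one_self_le_self) simp
      also have "e\<^sup>2 / (norm (T \<omega>))\<^sup>2 \<le> e\<^sup>2 / (1/4)"
        using t2 by (intro divide_left_mono) auto
      finally show ?thesis by simp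
    qed
    have clog: "continuous_on (sphere 0 1) (\<lambda>\<omega>. ln (norm (T \<omega>)))"
    proof (intro continuous_intros ballI)
      show "norm (T \<omega>) \<noteq> 0" if "\<omega> \<in> sphere 0 1" for \<omega> using T(1)[of \<omega>] that by auto
    qed
    have "circ_avg (\<lambda>\<omega>. trunc_log (a + cscale \<omega> b)) \<le> circ_avg (\<lambda>\<omega>. ln (norm (T \<omega>)) + 2 * e\<^sup>2)"
      using ln_le by (intro circ_avg_mono continuous_intros clog) auto
    also have "\<dots> = ln c + 2 * e\<^sup>2"
      using circ_avg_ln_norm[of "of_real c" r] clog
      by (simp add: circ_avg_add T_def r_def c_def)
    also have "ln c \<le> trunc_log (a + cscale 0 b)"
    proof -
      have "c \<le> sqrt (c\<^sup>2 + e\<^sup>2)" by (rule real_le_rsqrt) simp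
      then have h: "c \<le> norm (a + cscale 0 b)" unfolding nab T0 by simp
      have p: "0 < c" by (simp add: c_def)
      have "ln c \<le> ln (norm (a + cscale 0 b))"
        using h by (subst ln_le_cancel_iff[OF p less_le_trans[OF p h]])
      then show ?thesis using lo[of 0] by (simp add: trunc_log_outer)
    qed
    finally have gapu: "mean_gap trunc_log a b \<le> 2 * e\<^sup>2" by (simp add: mean_gap_def)
    have "disc_in_ball a b" unfolding disc_in_ball_def using up by blast
    from dominated_gap[OF f this] gapu have "norm D * norm (\<psi> e) \<le> 2 * e\<^sup>2"
      unfolding gap by (simp add: norm_mult)
    then show ?thesis using D by (simp add: field_simps)
  qed
  \<comment> \<open>The two sides of the contradiction: the derivative is zero by the quadratic bound, nonzero by explicit evaluation.\<close>
  have "L = 0" by (rule quadratic_bound_imp_derivative_0[OF _ der bound]) auto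
  define X where "X = of_nat N * x ^ M * x * y ^ (N - 1) - of_nat M * y * x ^ (M - 1) * y ^ N"
  have X: "X \<noteq> 0"
  proof -
    have a: "of_nat M * x ^ (M - 1) * x = of_nat M * x ^ M" using M by (simp flip: power_Suc2)
    have b: "of_nat N * y ^ (N - 1) * y = of_nat N * y ^ N" by (cases N) auto
    have "X * x * y = (of_nat N * y ^ (N - 1) * y) * x ^ M * x\<^sup>2 - (of_nat M * x ^ (M - 1) * x) * y\<^sup>2 * y ^ N"
      by (simp add: X_def algebra_simps power2_eq_square)
    also have "\<dots> = x ^ M * y ^ N * (N * x\<^sup>2 - M * y\<^sup>2)"
      unfolding a b by (simp add: algebra_simps)
    finally have "X * x * y = x ^ M * y ^ N * (N * x\<^sup>2 - M * y\<^sup>2)" .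
    then show ?thesis using xy by auto
  qed
  have Q'0: "Q' 0 t = X * (1 / (t * cnj t ^ k))" if "t \<noteq> 0" for t
  proof -
    have "P' 0 t * t = X * t ^ k"
    proof -
      have a: "of_nat M * t ^ (M - 1) * t = of_nat M * t ^ M" using M by (simp flip: power_Suc2)
      have b: "of_nat N * t ^ (N - 1) * t = of_nat N * t ^ N" by (cases N) auto
      have "P' 0 t * t = (of_nat N * t ^ (N - 1) * t) * t ^ M * x ^ M * x * y ^ (N - 1)
          - (of_nat M * t ^ (M - 1) * t) * t ^ N * y * x ^ (M - 1) * y ^ N"
        unfolding P'_def by (simp add: power_mult_distrib algebra_simps)
      also have "\<dots> = X * t ^ k"
        unfolding a b by (simp add: X_def k_def power_add algebra_simps)
      finally show ?thesis .
    qed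
    moreover have "R 0 t = t * cnj t" unfolding R_def complex_norm_square by simp
    moreover have "cnj t \<noteq> 0" using that by simp
    ultimately show ?thesis using that unfolding Q'_def
      by (simp add: power_mult_distrib divide_simps)
  qed
  have Tnz: "T \<omega> \<noteq> 0" if "norm \<omega> = 1" for \<omega> using T(1)[of \<omega>] that by auto
  have "circ_avg (\<lambda>\<omega>. Q' 0 (T \<omega>)) = circ_avg (\<lambda>\<omega>. X * (1 / (T \<omega> * cnj (T \<omega>) ^ k)))"
    by (rule circ_avg_cong) (rule Q'0[OF Tnz])
  also have "\<dots> = X * circ_avg (\<lambda>\<omega>. 1 / (T \<omega> * cnj (T \<omega>) ^ k))"
    using Tnz by (intro circ_avg_mult_left continuous_intros) auto
  also have "circ_avg (\<lambda>\<omega>. 1 / (T \<omega> * cnj (T \<omega>) ^ k)) = 1 / (c * (c - r\<^sup>2 / c) ^ k)"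
    unfolding T_def by (rule circ_avg_mixed_power) (auto simp: r_def c_def)
  finally have avgQ': "circ_avg (\<lambda>\<omega>. Q' 0 (T \<omega>)) = X * (1 / (c * (c - r\<^sup>2 / c) ^ k))"
    by simp
  have "complex_of_real c \<noteq> 0" by (simp add: c_def)
  from Q'0[OF this] have "L = X * (1 / (c * (c - r\<^sup>2 / c) ^ k) - 1 / (c * c ^ k))"
    unfolding L_def avgQ' by (simp add: algebra_simps)
  then have "X * (1 / (c * (c - r\<^sup>2 / c) ^ k) - 1 / (c * c ^ k)) = 0"
    using \<open>L = 0\<close> by (metis of_real_eq_0_iff)
  then have "(c - r\<^sup>2 / c) ^ k = c ^ k"
    using X by (simp add: c_def)
  then have "c - r\<^sup>2 / c = c"
    by (rule power_eq_imp_eq_base) (auto simp: c_def r_def power2_eq_square k)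
  then show False by (simp add: c_def r_def)
qed

section \<open>Dominated functions are multiples of the truncated logarithm\<close>

text \<open>
Near the origin a dominated function with character \<open>(m, n)\<close> is harmonic in each variable and along each line
through the origin. The three symmetries give the homogeneities \<open>\<bar>m\<bar>\<close>, \<open>\<bar>n\<bar>\<close> and \<open>\<bar>m + n\<bar>\<close>, which are
incompatible if \<open>m\<close> and \<open>n\<close> have opposite signs. Otherwise the function is a multiple of a holomorphic
monomial, its continuation through the shell is explicit, and displaced radial discs rule it out.
\<close>

lemma character_component_zero_pos:
  assumes f: "dominated f" and m: "0 < m"
    and c1: "\<And>\<eta> x y. norm \<eta> = 1 \<Longrightarrow> f (\<eta> * x, y) = hpow m \<eta> * f (x, y)"
    and c2: "\<And>\<eta> x y. norm \<eta> = 1 \<Longrightarrow> f (x, \<eta> * y) = hpow n \<eta> * f (x, y)"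
  shows "f z = 0"
proof -
  have c3: "f (cscale \<eta> z) = hpow (m + n) \<eta> * f z" if "norm \<eta> = 1" for \<eta> z
    using that by (simp add: cscale_def c1 c2 hpow_add)
  have small: "norm (x, y) \<le> exp (- 1) \<Longrightarrow> norm s \<le> 1 \<Longrightarrow> norm t \<le> 1 \<Longrightarrow> norm (s * x, t * y) \<le> exp (- 1)"
    for x y s t :: complex
  proof (erule order_trans[rotated])
    assume "norm s \<le> 1" "norm t \<le> 1"
    then have "norm (s * x) \<le> norm x" "norm (t * y) \<le> norm y"
      by (simp_all add: norm_mult mult_left_le_one_le)
    then show "norm (s * x, t * y) \<le> norm (x, y)"
      unfolding norm_Pair by (intro real_sqrt_le_mono add_mono power_mono) auto
  qed
  have i1: "f (t * x, y) = hpow m t * f (x, y)" if "norm (x, y) \<le> exp (- 1)" "norm t \<le> 1" for x y t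
    using dominated_inner_homogeneous[OF f, of "(0, y)" "(x, 0)" m t] that small[OF that(1), of _ 1]
    by (simp add: cscale_def c1)
  have i2: "f (x, t * y) = hpow n t * f (x, y)" if "norm (x, y) \<le> exp (- 1)" "norm t \<le> 1" for x y t
    using dominated_inner_homogeneous[OF f, of "(x, 0)" "(0, y)" n t] that small[OF that(1), of 1]
    by (simp add: cscale_def c2)
  have i3: "f (cscale t z) = hpow (m + n) t * f z" if "norm z \<le> exp (- 1)" "norm t \<le> 1" for z t
  proof -
    have "norm (cscale s z) \<le> exp (- 1)" if "norm s \<le> 1" for s
      using \<open>norm z \<le> exp (- 1)\<close> mult_left_le_one_le[of "norm z" "norm s"] that
      unfolding norm_cscale by simp
    then show ?thesis
      using dominated_inner_homogeneous[OF f, of 0 z "m + n" t] that by (simp add: c3)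
  qed
  have polar: "\<exists>\<zeta>. norm \<zeta> = 1 \<and> z = cscale (of_real (norm z)) \<zeta>" if "z \<noteq> 0" for z
  proof -
    have "norm (cscale (of_real (1 / norm z)) z) = 1" using that by (simp add: norm_cscale norm_divide)
    moreover have "z = cscale (of_real (norm z)) (cscale (of_real (1 / norm z)) z)"
      using that by (simp add: cscale_cscale)
    ultimately show ?thesis by blast
  qed
  show ?thesis
  proof (cases "n < 0")
    case True
    have inner: "f z = 0" if z: "norm z \<le> exp (- 1)" for z
    proof (rule ccontr)
      assume nz: "f z \<noteq> 0"
      obtain x y where xy: "z = (x, y)" by (cases z)
      have "norm (1 * x, (1/2) * y) \<le> exp (- 1)" using z xy by (intro small) auto
      then have "f (cscale (1/2) z) = hpow m (1/2) * (hpow n (1/2) * f z)"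
        using i1[of x "(1/2) * y" "1/2"] i2[of x y "1/2"] z unfolding xy cscale_def by simp
      then have "norm (hpow (m + n) (1/2)) = norm (hpow m (1/2)) * norm (hpow n (1/2))"
        using i3[OF z, of "1/2"] nz by (simp flip: norm_mult)
      then have "(1/2 :: real) ^ nat \<bar>m + n\<bar> = (1/2) ^ (nat \<bar>m\<bar> + nat \<bar>n\<bar>)"
        by (simp add: norm_hpow power_add)
      then have "nat \<bar>m + n\<bar> = nat \<bar>m\<bar> + nat \<bar>n\<bar>"
        by (subst (asm) power_inject_exp') auto
      then show False using True m by linarith
    qed
    show ?thesis
    proof (cases "norm z \<le> exp (- 1)")
      case False
      have "0 \<le> exp (- 1 :: real)" by simp
      then have "z \<noteq> 0" using False by auto
      then obtain \<zeta> where \<zeta>: "norm \<zeta> = 1" "z = cscale (of_real (norm z)) \<zeta>" using polar by blast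
      show ?thesis
      proof (cases "norm z \<le> 1")
        case True
        have "f (cscale (of_real (norm z)) \<zeta>) = 0"
          using False True \<zeta>(1)
          by (intro dominated_radial[OF f \<zeta>(1)]) (auto simp: inner norm_cscale mean_valued_on_def)
        then show ?thesis using \<zeta> by simp
      qed (simp add: dominated_outside[OF f])
    qed (rule inner)
  next
    case False
    define M where "M = nat m"
    define N where "N = nat n"
    have MN: "m = int M" "n = int N" "0 < M" using m False by (auto simp: M_def N_def)
    define k where "k = M + N"
    have k: "hpow m t = t ^ M" "hpow n t = t ^ N" "hpow (m + n) t = t ^ k" "k > 0" for t
      using MN by (auto simp: hpow_def k_def nat_add_distrib)
    \<comment> \<open>The bidisc of radius \<open>s\<close> lies in the inner ball, and halving maps the inner ball into this bidisc.\<close>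
    define s :: real where "s = exp (- 1) / 2"
    have s: "s > 0" by (simp add: s_def)
    define C where "C = f (of_real s, of_real s) / of_real s ^ k"
    have corner: "norm (x, y) \<le> exp (- 1)" if "norm x \<le> s" "norm y \<le> s" for x y :: complex
    proof -
      have "norm (x, y) \<le> norm x + norm y" by (rule norm_Pair_le)
      then show ?thesis using that by (simp add: s_def)
    qed
    have poly: "f (x, y) = C * (x ^ M * y ^ N)" if "norm x \<le> s" "norm y \<le> s" for x y
    proof -
      have 1: "norm (x / of_real s) \<le> 1" "norm (y / of_real s) \<le> 1"
        using that s by (simp_all add: norm_divide)
      have "f (x, y) = f ((x / of_real s) * of_real s, (y / of_real s) * of_real s)"
        using s by simp
      also have "\<dots> = (x / of_real s) ^ M * f (of_real s, (y / of_real s) * of_real s)"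
        by (subst i1) (use 1 that s in \<open>auto simp: k intro!: corner\<close>)
      also have "f (of_real s, (y / of_real s) * of_real s) = (y / of_real s) ^ N * f (of_real s, of_real s)"
        by (subst i2) (use 1 that s in \<open>auto simp: k intro!: corner\<close>)
      finally show ?thesis using s by (simp add: C_def k_def power_add power_divide field_simps)
    qed
    have inner: "f z = C * (fst z ^ M * snd z ^ N)" if z: "norm z \<le> exp (- 1)" for z
    proof -
      obtain x y where xy: "z = (x, y)" by (cases z)
      have "norm x \<le> exp (- 1)" "norm y \<le> exp (- 1)"
        using z norm_fst_le[of x y] norm_snd_le[of y x] unfolding xy by simp_all
      then have "f ((1/2) * x, (1/2) * y) = C * (((1/2) * x) ^ M * ((1/2) * y) ^ N)"
        by (intro poly) (auto simp: s_def norm_mult)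
      moreover have "f ((1/2) * x, (1/2) * y) = (1/2) ^ k * f z"
        using i3[OF z, of "1/2"] by (simp add: xy cscale_def k)
      ultimately show ?thesis by (simp add: xy k_def power_add power_divide field_simps)
    qed
    define q :: complex where "q = 1 - 1 / of_real (exp (- 1) ^ (2 * k))"
    have q: "q \<noteq> 0"
    proof
      assume "q = 0"
      then have "complex_of_real (exp (- 1) ^ (2 * k)) = of_real 1"
        by (simp add: q_def field_simps)
      then have "exp (- 1 :: real) ^ (2 * k) = 1" by (simp only: of_real_eq_iff)
      moreover have "exp (- 1 :: real) ^ (2 * k) < 1"
        using k by (subst power_less_one_iff) auto
      ultimately show False by simp
    qed
    define D where "D = C / q"
    have outer: "f z = D * (fst z ^ M * snd z ^ N) * (1 - 1 / of_real (norm z ^ (2 * (M + N))))"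
      if z: "exp (- 1) \<le> norm z" "norm z \<le> 1" for z
    proof -
      have "0 < exp (- 1 :: real)" by simp
      then have "z \<noteq> 0" using z by auto
      then obtain \<zeta> where \<zeta>: "norm \<zeta> = 1" "z = cscale (of_real (norm z)) \<zeta>" using polar by blast
      define E where "E = D * (fst \<zeta> ^ M * snd \<zeta> ^ N)"
      define h where "h = (\<lambda>t::complex. E * (t ^ k - cnj (1 / t ^ k)))"
      have nz: "t \<noteq> 0" if "exp (- 1) \<le> norm t" for t :: complex
        using that \<open>0 < exp (- 1 :: real)\<close> by auto
      have h: "h t = E * (t ^ k * (1 - 1 / of_real (norm t ^ (2 * k))))" if "t \<noteq> 0" for t
        unfolding h_def using recip_power[OF that, of k] by simp
      have "f (cscale (of_real (norm z)) \<zeta>) = h (of_real (norm z))"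
      proof (rule dominated_radial[OF f \<zeta>(1)])
        show "continuous_on {t. exp (- 1) \<le> norm t \<and> norm t \<le> 1} h"
          unfolding h_def using nz by (intro continuous_intros) auto
        let ?S = "{t::complex. exp (- 1) < norm t \<and> norm t < 1}"
        have S: "open ?S" by (intro open_Collect_conj open_Collect_less continuous_intros)
        have nzS: "t \<noteq> 0" if "t \<in> ?S" for t using that nz[of t] by simp
        have mv1: "mean_valued_on ?S (\<lambda>t. t ^ k)"
          by (intro mean_valued_holomorphic S holomorphic_intros)
        have mv2: "mean_valued_on ?S (\<lambda>t. 1 / t ^ k)"
          using nzS by (intro mean_valued_holomorphic S holomorphic_intros) auto
        have ct: "continuous_on ?S (\<lambda>t. 1 / t ^ k)" using nzS by (intro continuous_intros) auto
        show "mean_valued_on ?S h"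
          unfolding h_def
          by (intro mean_valued_cmult mean_valued_diff mv1 mean_valued_cnj mv2 continuous_intros ct)
             (use nzS in auto)
        show "h t = f (cscale t \<zeta>)" if t: "norm t = exp (- 1)" for t
        proof -
          have "norm (cscale t \<zeta>) \<le> exp (- 1)" using t \<zeta>(1) by (simp add: norm_cscale)
          from inner[OF this] have "f (cscale t \<zeta>) = C * ((t * fst \<zeta>) ^ M * (t * snd \<zeta>) ^ N)"
            unfolding cscale_def by simp
          also have "\<dots> = h t"
            using nz[of t] t q by (simp add: h E_def D_def q_def k_def power_mult_distrib power_add)
          finally show ?thesis by simp
        qed
        show "h t = 0" if "norm t = 1" for t
        proof -
          have "t \<noteq> 0" using that by auto
          then show ?thesis using that by (simp add: h)
        qed
      qed (use z in auto)
      then have "f z = h (of_real (norm z))" using \<zeta>(2) by simp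
      also have "\<dots> = D * ((of_real (norm z) * fst \<zeta>) ^ M * (of_real (norm z) * snd \<zeta>) ^ N) * (1 - 1 / of_real (norm z ^ (2 * k)))"
        using \<open>z \<noteq> 0\<close> by (simp add: h E_def k_def power_mult_distrib power_add)
      also have "of_real (norm z) * fst \<zeta> = fst z"
        by (subst (2) \<zeta>(2)) (simp add: cscale_def)
      also have "of_real (norm z) * snd \<zeta> = snd z"
        by (subst (2) \<zeta>(2)) (simp add: cscale_def)
      finally show ?thesis by (simp add: k_def)
    qed
    have "D = 0" by (rule monomial_coefficient_zero[OF f \<open>0 < M\<close> outer])
    then have "C = 0" using q by (simp add: D_def)
    show ?thesis
    proof (cases "norm z \<le> 1")
      case True
      then show ?thesis using inner[of z] outer[of z] \<open>D = 0\<close> \<open>C = 0\<close> by force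
    qed (simp add: dominated_outside[OF f])
  qed
qed

lemma character_component_zero:
  assumes f: "dominated f" and m: "m \<noteq> 0"
    and c1: "\<And>\<eta> x y. norm \<eta> = 1 \<Longrightarrow> f (\<eta> * x, y) = hpow m \<eta> * f (x, y)"
    and c2: "\<And>\<eta> x y. norm \<eta> = 1 \<Longrightarrow> f (x, \<eta> * y) = hpow n \<eta> * f (x, y)"
  shows "f z = 0"
proof (cases "m > 0")
  case True
  then show ?thesis using character_component_zero_pos[OF f True c1 c2] by blast
next
  case False
  have "cnj (f z) = 0"
    by (rule character_component_zero_pos[OF dominated_cnj[OF f], of "- m" "- n"])
       (use False m in \<open>auto simp: c1 c2 cnj_hpow\<close>)
  then show ?thesis by simp
qed

text \<open>
A nontrivial component in the first coordinate is in turn determined by its components in the second,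
and all of these vanish.
\<close>

lemma fourier_component_zero:
  assumes f: "dominated f" and m: "m \<noteq> 0"
  shows "fourier m f z = 0"
proof -
  obtain x y where z: "z = (x, y)" by (cases z)
  define g where "g = fourier m f"
  have g: "dominated g" unfolding g_def by (rule dominated_fourier[OF f])
  define g' where "g' = (\<lambda>z. g (prod.swap z))"
  have g': "dominated g'" unfolding g'_def by (rule dominated_swap[OF g])
  have gc: "g (\<eta> * x, y) = hpow m \<eta> * g (x, y)" if "norm \<eta> = 1" for \<eta> x y
    using fourier_rot[OF f that, of m "(x, y)"] by (simp add: g_def rot_def)
  have zero: "fourier n g' w = 0" for n w
  proof -
    define F where "F = (\<lambda>z. fourier n g' (prod.swap z))"
    have F: "dominated F" unfolding F_def by (intro dominated_swap dominated_fourier g')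
    have "F (x, \<eta> * y) = hpow n \<eta> * F (x, y)" if "norm \<eta> = 1" for \<eta> x y
      using fourier_rot[OF g' that, of n "(y, x)"] by (simp add: F_def rot_def)
    moreover have "F (\<eta> * x, y) = hpow m \<eta> * F (x, y)" if \<eta>: "norm \<eta> = 1" for \<eta> x y
    proof -
      have "F (\<eta> * x, y) = circ_avg (\<lambda>\<xi>. hpow m \<eta> * (g' (rot \<xi> (y, x)) * hpow (- n) \<xi>))"
        by (simp add: F_def fourier_def rot_def g'_def gc[OF \<eta>] mult_ac)
      also have "\<dots> = hpow m \<eta> * F (x, y)"
        unfolding F_def fourier_def prod.swap_def
        by (subst circ_avg_mult_left) (auto intro!: continuous_intros dominated_cont[OF g'])
      finally show ?thesis .
    qed
    ultimately have "F (prod.swap w) = 0" by (intro character_component_zero[OF F m]) auto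
    then show ?thesis by (simp add: F_def)
  qed
  have "g' (rot 1 (y, x)) = 0"
  proof (rule fourier_unique[of "\<lambda>\<eta>. g' (rot \<eta> (y, x))"])
    show "continuous_on (sphere 0 1) (\<lambda>\<eta>. g' (rot \<eta> (y, x)))"
      by (intro continuous_intros dominated_cont[OF g'])
    show "circ_avg (\<lambda>\<eta>. g' (rot \<eta> (y, x)) * hpow k \<eta>) = 0" for k
      using zero[of "- k" "(y, x)"] by (simp add: fourier_def)
  qed auto
  then show ?thesis by (simp add: g'_def g_def z)
qed

text \<open>
Along the orbit of \<open>z\<close> every Fourier coefficient other than the mean vanishes.
\<close>

lemma dominated_rot_invariant:
  assumes f: "dominated f" and \<eta>: "norm \<eta> = 1"
  shows "f (rot \<eta> z) = f z"
proof -
  have "f (rot \<eta> z) - fourier 0 f z = 0" if \<eta>: "norm \<eta> = 1" for \<eta>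
  proof (rule fourier_unique[of "\<lambda>\<eta>. f (rot \<eta> z) - fourier 0 f z", OF _ _ \<eta>])
    have cont: "continuous_on (sphere 0 1) (\<lambda>\<eta>. f (rot \<eta> z))"
      by (intro continuous_intros dominated_cont[OF f])
    then show "continuous_on (sphere 0 1) (\<lambda>\<eta>. f (rot \<eta> z) - fourier 0 f z)"
      by (intro continuous_intros)
    fix k
    have "circ_avg (\<lambda>\<eta>. (f (rot \<eta> z) - fourier 0 f z) * hpow k \<eta>)
        = circ_avg (\<lambda>\<eta>. f (rot \<eta> z) * hpow k \<eta> - fourier 0 f z * hpow k \<eta>)"
      by (simp add: algebra_simps)
    also have "\<dots> = circ_avg (\<lambda>\<eta>. f (rot \<eta> z) * hpow k \<eta>) - circ_avg (\<lambda>\<eta>. fourier 0 f z * hpow k \<eta>)"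
      by (intro circ_avg_diff continuous_intros cont)
    also have "circ_avg (\<lambda>\<eta>. f (rot \<eta> z) * hpow k \<eta>) = fourier (- k) f z"
      by (simp add: fourier_def)
    also have "circ_avg (\<lambda>\<eta>. fourier 0 f z * hpow k \<eta>) = fourier 0 f z * circ_avg (hpow k)"
      by (intro circ_avg_mult_left continuous_intros)
    also have "circ_avg (hpow k) = hpow k 0"
      using mean_valued_hpow[of UNIV k] unfolding mean_valued_on_def by (force dest: spec[of _ 0] spec[of _ 1])
    finally show "circ_avg (\<lambda>\<eta>. (f (rot \<eta> z) - fourier 0 f z) * hpow k \<eta>) = 0"
      using fourier_component_zero[OF f, of "- k" z] by (cases "k = 0") (auto simp: hpow_def)
  qed
  from this[OF \<eta>] this[of 1] show ?thesis by simp
qed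

text \<open>
Invariance under the torus makes \<open>f\<close> radial on every line through the origin: constant inside, and outside
the multiple of the logarithm with the same values on the inner sphere.
\<close>

lemma dominated_eq_multiple:
  assumes f: "dominated f" and z: "norm z \<le> 1"
  shows "f z = - f 0 * of_real (trunc_log z)"
proof -
  have "f (prod.swap (rot \<eta> w)) = f (prod.swap w)" if "norm \<eta> = 1" for \<eta> w
    using dominated_rot_invariant[OF dominated_swap[OF f] that] .
  from this[where w = "(snd w, fst w)" for w]
  have "f (x, \<eta> * y) = f (x, y)" if "norm \<eta> = 1" for \<eta> x y
    using that by (auto simp: rot_def)
  moreover have "f (\<eta> * x, y) = f (x, y)" if "norm \<eta> = 1" for \<eta> x y
    using dominated_rot_invariant[OF f that, of "(x, y)"] by (simp add: rot_def)
  ultimately have circ: "f (cscale \<eta> w) = f w" if "norm \<eta> = 1" for \<eta> w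
    using that by (cases w) (simp add: cscale_def)
  have inner: "f w = f 0" if w: "norm w \<le> exp (- 1)" for w
  proof -
    have "norm (cscale s w) \<le> exp (- 1)" if "norm s \<le> 1" for s
      using w mult_left_le_one_le[of "norm w" "norm s"] that unfolding norm_cscale by simp
    then show ?thesis
      using dominated_inner_homogeneous[OF f, of 0 w 0 0] by (simp add: circ)
  qed
  show ?thesis
  proof (cases "norm z \<le> exp (- 1)")
    case True
    then show ?thesis using inner[of z] by (simp add: trunc_log_inner)
  next
    case False
    have pos: "0 < exp (- 1 :: real)" by simp
    then have nz: "z \<noteq> 0" using False by auto
    define \<zeta> where "\<zeta> = cscale (of_real (1 / norm z)) z"
    have \<zeta>: "norm \<zeta> = 1" "z = cscale (of_real (norm z)) \<zeta>"
      using nz by (simp_all add: \<zeta>_def norm_cscale norm_divide cscale_cscale)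
    have "f (cscale (of_real (norm z)) \<zeta>) = - f 0 * of_real (ln (norm (complex_of_real (norm z))))"
    proof (rule dominated_radial[OF f \<zeta>(1), where h = "\<lambda>t. - f 0 * of_real (ln (norm t))"])
      show "continuous_on {t. exp (- 1) \<le> norm t \<and> norm t \<le> 1} (\<lambda>t. - f 0 * of_real (ln (norm t)))"
        using pos by (intro continuous_intros) auto
      show "mean_valued_on {t. exp (- 1) < norm t \<and> norm t < 1} (\<lambda>t. - f 0 * of_real (ln (norm t)))"
        using pos by (intro mean_valued_cmult mean_valued_ln continuous_intros) auto
      show "- f 0 * of_real (ln (norm t)) = f (cscale t \<zeta>)" if "norm t = exp (- 1)" for t
        using inner[of "cscale t \<zeta>"] that \<zeta> by (simp add: norm_cscale)
    qed (use z False in auto)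
    then show ?thesis using \<zeta>(2) False by (simp add: trunc_log_outer)
  qed
qed

section \<open>Passage to the plurisubharmonic cone\<close>

lemma trunc_log_eq_max: "z \<noteq> 0 \<Longrightarrow> trunc_log z = max (ln (norm z)) (- 1)"
  using ln_mono[of "exp (-1)" "norm z"] ln_mono[of "norm z" "exp (-1)"]
  by (auto simp: trunc_log_def max_def)

lemma trunc_log_ge: "- 1 \<le> trunc_log z"
  using ln_mono[of "exp (-1)" "max (norm z) (exp (-1))"] by (simp add: trunc_log_def)

lemma trunc_log_nonpos: "norm z \<le> 1 \<Longrightarrow> trunc_log z \<le> 0"
  unfolding trunc_log_def by (subst ln_le_zero_iff) (auto simp: less_max_iff_disj)

text \<open>
If \<open>norm \<beta> < A\<close>, the logarithm is harmonic on the disc. If \<open>norm \<beta> > A\<close>, conjugation on the circle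
exchanges the roles of \<open>A\<close> and \<open>\<beta>\<close> and moves the zero out of the disc. Equality puts a zero on the
circle; there \<open>\<beta>\<close> is shrunk slightly, and the truncation makes the integrand Lipschitz in \<open>\<beta>\<close>.
\<close>

lemma ln_max_submean:
  fixes A :: real and \<beta> :: complex
  assumes A: "exp (- 1) \<le> A"
  shows "ln A \<le> circ_avg (\<lambda>\<omega>. ln (max (norm (A + \<omega> * \<beta>)) (exp (- 1))))"
proof -
  let ?\<rho> = "exp (- 1) :: real"
  define \<Lambda> where "\<Lambda> = (\<lambda>w::complex. ln (max (norm w) ?\<rho>))"
  have pos: "0 < ?\<rho>" "0 < A" using A exp_gt_zero[of "-1::real"] by linarith+
  have cont: "continuous_on S (\<lambda>\<omega>. \<Lambda> (g \<omega>))" if "continuous_on S g" for S :: "complex set" and g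
    unfolding \<Lambda>_def using pos by (intro continuous_intros that) (auto simp: max_def)
  have \<Lambda>_ge: "ln (norm w) \<le> \<Lambda> w" if "w \<noteq> 0" for w
    unfolding \<Lambda>_def using that by (intro ln_mono) auto
  have small: "ln (norm a) \<le> circ_avg (\<lambda>\<omega>. \<Lambda> (a + \<omega> * b))" if ab: "norm b < norm a" for a b
  proof -
    obtain \<eta> where \<eta>: "norm \<eta> = 1" "b = \<eta> * of_real (norm b)"
    proof (cases "b = 0")
      case False
      then show ?thesis by (intro that[of "b / of_real (norm b)"]) (auto simp: norm_divide)
    qed (use that[of 1] in auto)
    have in0: "0 \<notin> cball a (norm b)" using ab by (simp add: dist_norm)
    have nz: "a + \<omega> * of_real (norm b) \<noteq> 0" if "norm \<omega> = 1" for \<omega>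
      using affine_in_cball[of \<omega> "norm b" a] that in0 by auto
    have "ln (norm a) = circ_avg (\<lambda>\<omega>. ln (norm (a + \<omega> * of_real (norm b))))"
      using circ_avg_ln_norm[OF in0] by simp
    also have "\<dots> \<le> circ_avg (\<lambda>\<omega>. \<Lambda> (a + \<omega> * of_real (norm b)))"
      using nz by (intro circ_avg_mono cont continuous_intros \<Lambda>_ge) auto
    also have "\<dots> = circ_avg (\<lambda>\<omega>. \<Lambda> (a + (\<eta> * \<omega>) * of_real (norm b)))"
      by (rule circ_avg_rotate[symmetric]) (intro cont continuous_intros \<eta>(1))+
    also have "\<dots> = circ_avg (\<lambda>\<omega>. \<Lambda> (a + \<omega> * b))"
    proof -
      have "\<eta> * \<omega> * of_real (norm b) = \<omega> * (\<eta> * of_real (norm b))" for \<omega> by (simp add: mult_ac)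
      then have "\<eta> * \<omega> * of_real (norm b) = \<omega> * b" for \<omega> by (simp flip: \<eta>(2))
      then show ?thesis by (simp only:)
    qed
    finally show ?thesis .
  qed
  have "ln A \<le> circ_avg (\<lambda>\<omega>. \<Lambda> (A + \<omega> * \<beta>))"
  proof (cases "norm \<beta> \<le> A")
    case True
    have "ln A \<le> circ_avg (\<lambda>\<omega>. \<Lambda> (A + \<omega> * \<beta>)) + e" if e: "e > 0" for e
    proof -
      define s where "s = 1 - min (1/2) (e * ?\<rho> / A)"
      have s: "0 < s" "s < 1" "(1 - s) * A \<le> e * ?\<rho>"
        using e pos by (auto simp: s_def min_def field_simps)
      have lip: "\<Lambda> (A + \<omega> * (s * \<beta>)) \<le> \<Lambda> (A + \<omega> * \<beta>) + e" if "norm \<omega> = 1" for \<omega> :: complex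
      proof -
        define p where "p = max (norm (A + \<omega> * (s * \<beta>))) ?\<rho>"
        define q where "q = max (norm (A + \<omega> * \<beta>)) ?\<rho>"
        have pq: "p > 0" "q \<ge> ?\<rho>" "q > 0" using pos by (auto simp: p_def q_def less_max_iff_disj)
        have "norm (A + \<omega> * (s * \<beta>)) \<le> norm (A + \<omega> * \<beta>) + norm (\<omega> * (of_real (1 - s) * \<beta>))"
          using norm_triangle_ineq4[of "A + \<omega> * \<beta>" "\<omega> * (of_real (1 - s) * \<beta>)"] by (simp add: algebra_simps)
        also have "norm (\<omega> * (of_real (1 - s) * \<beta>)) = (1 - s) * norm \<beta>"
          using that s by (simp add: norm_mult del: of_real_diff)
        also have "\<dots> \<le> (1 - s) * A" using True s by (intro mult_left_mono) auto
        finally have "norm (A + \<omega> * (s * \<beta>)) \<le> norm (A + \<omega> * \<beta>) + e * ?\<rho>" using s(3) by simp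
        moreover have "0 \<le> e * ?\<rho>" using e by simp
        ultimately have "p \<le> q + e * ?\<rho>" unfolding p_def q_def by linarith
        also have "\<dots> \<le> q * (1 + e)" using pq e by (simp add: algebra_simps)
        finally have "ln p \<le> ln (q * (1 + e))" using pq by (intro ln_mono) auto
        also have "\<dots> = ln q + ln (1 + e)" using pq e by (intro ln_mult_pos) auto
        also have "\<dots> \<le> ln q + e" using e by (simp add: ln_add_one_self_le_self)
        finally show ?thesis by (simp add: \<Lambda>_def p_def q_def)
      qed
      have "norm (s * \<beta>) < norm (complex_of_real A)"
      proof (cases "\<beta> = 0")
        case False
        then have "s * norm \<beta> < 1 * norm \<beta>" using s by (intro mult_strict_right_mono) auto
        then show ?thesis using True s pos by (simp add: norm_mult)
      qed (use pos in auto)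
      from small[OF this] have "ln A \<le> circ_avg (\<lambda>\<omega>. \<Lambda> (A + \<omega> * (s * \<beta>)))" using pos by simp
      also have "\<dots> \<le> circ_avg (\<lambda>\<omega>. \<Lambda> (A + \<omega> * \<beta>) + e)"
        using lip by (intro circ_avg_mono cont continuous_intros) auto
      also have "\<dots> = circ_avg (\<lambda>\<omega>. \<Lambda> (A + \<omega> * \<beta>)) + e"
        by (subst circ_avg_add) (auto intro!: cont continuous_intros)
      finally show ?thesis .
    qed
    then show ?thesis by (rule field_le_epsilon)
  next
    case False
    have "ln A \<le> ln (norm (cnj \<beta>))" using False pos by (intro ln_mono) auto
    also have "\<dots> \<le> circ_avg (\<lambda>\<omega>. \<Lambda> (cnj \<beta> + \<omega> * A))"
      using False pos by (intro small) auto
    also have "\<dots> = circ_avg (\<lambda>\<omega>. \<Lambda> (A + \<omega> * \<beta>))"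
    proof (rule circ_avg_cong)
      fix \<omega> :: complex assume \<omega>: "norm \<omega> = 1"
      then have 1: "\<omega> * cnj \<omega> = 1" by (simp add: complex_mult_cnj cmod_def)
      have "\<omega> * cnj (A + \<omega> * \<beta>) = (\<omega> * cnj \<omega>) * cnj \<beta> + \<omega> * A"
        by (simp add: algebra_simps)
      then have "cnj \<beta> + \<omega> * A = \<omega> * cnj (A + \<omega> * \<beta>)" unfolding 1 by simp
      then have "norm (cnj \<beta> + \<omega> * A) = norm (A + \<omega> * \<beta>)"
        using \<omega> by (simp only: norm_mult complex_mod_cnj)
      then show "\<Lambda> (cnj \<beta> + \<omega> * A) = \<Lambda> (A + \<omega> * \<beta>)" by (simp add: \<Lambda>_def)
    qed
    finally show ?thesis .
  qed
  then show ?thesis by (simp add: \<Lambda>_def)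
qed

text \<open>
The component of \<open>a + \<omega> b\<close> in the direction of \<open>a\<close> is an affine function of \<open>\<omega>\<close> whose modulus does
not exceed the norm and agrees with it at the centre; this reduces the claim to one variable.
\<close>

lemma trunc_log_submean: "0 \<le> mean_gap trunc_log a b"
proof -
  have cont: "continuous_on (sphere 0 1) (\<lambda>\<omega>. trunc_log (a + cscale \<omega> b))"
    by (intro continuous_intros)
  have "trunc_log a \<le> circ_avg (\<lambda>\<omega>. trunc_log (a + cscale \<omega> b))"
  proof (cases "norm a \<le> exp (- 1)")
    case True
    have "circ_avg (\<lambda>_. - 1) \<le> circ_avg (\<lambda>\<omega>. trunc_log (a + cscale \<omega> b))"
      by (intro circ_avg_mono cont continuous_intros trunc_log_ge)
    then show ?thesis using True by (simp add: trunc_log_inner)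
  next
    case False
    obtain a1 a2 where a: "a = (a1, a2)" by (cases a)
    obtain b1 b2 where b: "b = (b1, b2)" by (cases b)
    have na: "norm a > 0" "(norm a)\<^sup>2 = (norm a1)\<^sup>2 + (norm a2)\<^sup>2"
      using False exp_gt_zero[of "-1::real"] unfolding a norm_Pair by (linarith, simp)
    define \<beta> where "\<beta> = (b1 * cnj a1 + b2 * cnj a2) / of_real (norm a)"
    have le: "norm (norm a + \<omega> * \<beta>) \<le> norm (a + cscale \<omega> b)" for \<omega>
    proof -
      define z1 where "z1 = a1 + \<omega> * b1"
      define z2 where "z2 = a2 + \<omega> * b2"
      have 1: "of_real ((norm a)\<^sup>2) = a1 * cnj a1 + a2 * cnj a2"
        unfolding na of_real_add complex_norm_square ..
      have 2: "of_real (norm a) * \<beta> = b1 * cnj a1 + b2 * cnj a2"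
        using na(1) by (simp add: \<beta>_def)
      have "of_real (norm a) * (of_real (norm a) + \<omega> * \<beta>)
          = of_real ((norm a)\<^sup>2) + \<omega> * (of_real (norm a) * \<beta>)"
        by (simp add: algebra_simps power2_eq_square)
      also have "\<dots> = z1 * cnj a1 + z2 * cnj a2"
        unfolding 1 2 by (simp add: z1_def z2_def algebra_simps)
      finally have "norm a * norm (norm a + \<omega> * \<beta>) = norm (z1 * cnj a1 + z2 * cnj a2)"
        by (metis norm_mult norm_of_real abs_norm_cancel)
      also have "\<dots> \<le> norm z1 * norm a1 + norm z2 * norm a2"
        by (rule order_trans[OF norm_triangle_ineq]) (simp add: norm_mult)
      also have "\<dots> = (norm z1, norm z2) \<bullet> (norm a1, norm a2)" by simp
      also have "\<dots> \<le> norm (norm z1, norm z2) * norm (norm a1, norm a2)"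
        by (rule norm_cauchy_schwarz)
      also have "\<dots> = norm a * norm (a + cscale \<omega> b)"
        by (simp add: a b cscale_def norm_Pair z1_def z2_def)
      finally show ?thesis using na(1) by simp
    qed
    have pos: "0 < max x (exp (- 1))" for x :: real by (simp add: less_max_iff_disj)
    have "trunc_log a = ln (norm a)" using False by (simp add: trunc_log_outer)
    also have "\<dots> \<le> circ_avg (\<lambda>\<omega>. ln (max (norm (norm a + \<omega> * \<beta>)) (exp (- 1))))"
      using False by (intro ln_max_submean) auto
    also have "\<dots> \<le> circ_avg (\<lambda>\<omega>. trunc_log (a + cscale \<omega> b))"
    proof (rule circ_avg_mono[OF _ cont])
      show "continuous_on (sphere 0 1) (\<lambda>\<omega>. ln (max (norm (norm a + \<omega> * \<beta>)) (exp (- 1))))"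
        by (intro continuous_intros) (auto simp: max_def)
      show "ln (max (norm (norm a + \<omega> * \<beta>)) (exp (- 1))) \<le> trunc_log (a + cscale \<omega> b)" for \<omega>
        unfolding trunc_log_def using pos by (intro ln_mono max.mono le order_refl) auto
    qed
    finally show ?thesis .
  qed
  then show ?thesis by (simp add: mean_gap_def)
qed

definition pair_of :: "complex ^ 2 \<Rightarrow> complex \<times> complex" where
  "pair_of z = (z $ 1, z $ 2)"

definition vec_of :: "complex \<times> complex \<Rightarrow> complex ^ 2" where
  "vec_of p = (\<chi> i. if i = 1 then fst p else snd p)"

lemma pair_vec [simp]: "pair_of (vec_of p) = p"
  by (simp add: pair_of_def vec_of_def)

lemma vec_pair [simp]: "vec_of (pair_of z) = z"
  by (simp add: pair_of_def vec_of_def vec_eq_iff forall_2)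

lemma norm_pair_of [simp]: "norm (pair_of z) = norm z"
  by (simp add: pair_of_def norm_Pair norm_vec_def L2_set_def sum_2)

lemma norm_vec_of [simp]: "norm (vec_of p) = norm p"
  using norm_pair_of[of "vec_of p"] by simp

lemma pair_of_line: "pair_of (a + t *s b) = pair_of a + cscale t (pair_of b)"
  by (simp add: pair_of_def cscale_def)

lemma vec_of_line: "vec_of (a + cscale t b) = vec_of a + t *s vec_of b"
  by (simp add: vec_of_def cscale_def vec_eq_iff)

lemma continuous_on_pair_of [continuous_intros]:
  "continuous_on S f \<Longrightarrow> continuous_on S (\<lambda>x. pair_of (f x))"
  unfolding pair_of_def by (intro continuous_intros)

lemma continuous_on_vec_of [continuous_intros]:
  assumes "continuous_on S f"
  shows "continuous_on S (\<lambda>x. vec_of (f x))"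
proof -
  have "continuous_on S (\<lambda>x. if i = 1 then fst (f x) else snd (f x))" for i :: 2
    by (cases "i = 1") (auto intro!: continuous_intros assms)
  then show ?thesis unfolding vec_of_def by (intro continuous_intros)
qed

text \<open>
For a nonpositive function the positive part of the mean is zero and the negative part is finite.
\<close>

lemma circle_mean_eq_circ_avg:
  assumes g: "continuous_on (sphere 0 1) g" and le: "\<And>\<omega>. norm \<omega> = 1 \<Longrightarrow> g \<omega> \<le> 0"
    and eq: "\<And>\<omega>. norm \<omega> = 1 \<Longrightarrow> u (c + of_real r * \<omega>) = ereal (g \<omega>)"
  shows "circle_mean u c r = ereal (circ_avg g)"
proof -
  let ?I = "integral {0..2 * pi} (\<lambda>t. g (cis t))"
  have "((\<lambda>t. - g (cis t)) has_integral - ?I) {0..2 * pi}"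
    by (intro has_integral_neg integrable_integral cis_integrable g)
  then have "(\<integral>\<^sup>+ t \<in> {0..2 * pi}. ennreal (- g (cis t)) \<partial>lborel) = ennreal (- ?I)"
    using le by (intro nn_integral_has_integral_lebesgue') auto
  then have 1: "(\<integral>\<^sup>+ t \<in> {0..2 * pi}. e2ennreal (- u (c + of_real r * cis t)) \<partial>lborel) = ennreal (- ?I)"
    by (simp add: eq)
  have 2: "(\<integral>\<^sup>+ t \<in> {0..2 * pi}. e2ennreal (u (c + of_real r * cis t)) \<partial>lborel) = 0"
    using le by (simp add: eq ennreal_neg)
  have "?I \<le> 0"
    using integral_le[OF cis_integrable[OF g] integrable_0, of 0 "2*pi"] le by simp
  then show ?thesis
    unfolding circle_mean_def 1 2 circ_avg_def by (simp add: zero_ennreal.rep_eq)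
qed

lemma usc_on_continuous:
  fixes g :: "'a::topological_space \<Rightarrow> real"
  assumes g: "continuous_on U g" and eq: "\<And>x. x \<in> U \<Longrightarrow> u x = ereal (g x)"
  shows "usc_on U u"
  unfolding usc_on_def
proof
  fix c
  have "continuous_on U (\<lambda>x. ereal (g x))" by (intro continuous_intros g)
  then have "openin (top_of_set U) (U \<inter> (\<lambda>x. ereal (g x)) -` {..<c})"
    by (rule continuous_openin_preimage_gen) auto
  also have "U \<inter> (\<lambda>x. ereal (g x)) -` {..<c} = {x \<in> U. u x < c}" using eq by auto
  finally show "openin (top_of_set U) {x \<in> U. u x < c}" .
qed

lemma max_log_norm_eq:
  fixes z :: "complex ^ 2"
  shows "max (log_norm z) (- 1) = ereal (trunc_log (pair_of z))"
proof (cases "z = 0")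
  case True
  then have "norm (pair_of z) = 0" by simp
  then have "trunc_log (pair_of z) = - 1" by (intro trunc_log_inner) simp
  then show ?thesis using True by (simp add: log_norm_def one_ereal_def)
next
  case False
  then have "norm (pair_of z) \<noteq> 0" by simp
  then have "pair_of z \<noteq> 0" by (metis norm_zero)
  then show ?thesis using False
    by (simp add: log_norm_def trunc_log_eq_max one_ereal_def max_def)
qed

lemma max_log_norm_in_cone:
  "(\<lambda>z. max (log_norm z) (- 1)) \<in> neg_psh_cone (ball (0 :: complex ^ 2) 1)"
  unfolding neg_psh_cone_def psh_on_def subharmonic_on_def mem_Collect_eq max_log_norm_eq
proof (intro conjI allI ballI impI)
  let ?B = "ball (0 :: complex ^ 2) 1"
  show "usc_on ?B (\<lambda>z. ereal (trunc_log (pair_of z)))"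
    by (rule usc_on_continuous[of _ "\<lambda>z. trunc_log (pair_of z)"]) (auto intro!: continuous_intros)
  show "ereal (trunc_log (pair_of z)) \<le> 0" if "z \<in> ?B" for z
    using that by (simp add: trunc_log_nonpos)
  fix a b :: "complex ^ 2"
  have line: "continuous_on UNIV (\<lambda>t. a + t *s b)"
    unfolding vector_scalar_mult_def by (intro continuous_intros)
  have "{t. a + t *s b \<in> ?B} = (\<lambda>t. a + t *s b) -` ?B" by auto
  then show "open {t. a + t *s b \<in> ?B}" using line by (simp add: open_vimage)
  show "usc_on {t. a + t *s b \<in> ?B} (\<lambda>t. ereal (trunc_log (pair_of (a + t *s b))))"
    unfolding pair_of_line
    by (rule usc_on_continuous[of _ "\<lambda>t. trunc_log (pair_of a + cscale t (pair_of b))"])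
       (auto intro!: continuous_intros)
  fix c :: complex and r :: real
  assume r: "r > 0 \<and> cball c r \<subseteq> {t. a + t *s b \<in> ?B}"
  define a' where "a' = pair_of a + cscale c (pair_of b)"
  define b' where "b' = cscale (of_real r) (pair_of b)"
  have ab: "pair_of (a + (c + of_real r * \<omega>) *s b) = a' + cscale \<omega> b'" for \<omega>
    unfolding pair_of_line a'_def b'_def by (simp add: cscale_add cscale_cscale mult.commute)
  have neg: "trunc_log (a' + cscale \<omega> b') \<le> 0" if "norm \<omega> = 1" for \<omega>
  proof -
    have "c + \<omega> * of_real r \<in> cball c r" using affine_in_cball[of \<omega> r c] that r by simp
    then have "norm (a + (c + of_real r * \<omega>) *s b) < 1" using r by (auto simp: mult.commute)
    then show ?thesis unfolding ab[symmetric] by (intro trunc_log_nonpos) simp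
  qed
  have "circle_mean (\<lambda>t. ereal (trunc_log (pair_of (a + t *s b)))) c r
      = ereal (circ_avg (\<lambda>\<omega>. trunc_log (a' + cscale \<omega> b')))"
  proof (rule circle_mean_eq_circ_avg)
    show "continuous_on (sphere 0 1) (\<lambda>\<omega>. trunc_log (a' + cscale \<omega> b'))"
      by (intro continuous_intros)
  qed (simp_all only: neg ab)
  moreover have "pair_of (a + c *s b) = a'" using ab[of 0] by simp
  ultimately show "ereal (trunc_log (pair_of (a + c *s b)))
      \<le> circle_mean (\<lambda>t. ereal (trunc_log (pair_of (a + t *s b)))) c r"
    using trunc_log_submean[of a' b'] by (simp add: mean_gap_def)
qed auto

text \<open>
Summands of a finite function that are nonpositive are themselves finite, so nothing is lost in passing to
reals. The value 0 outside the ball is the boundary limit of the summands, as they lie between the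
truncated logarithm and 0.
\<close>

definition extend0 :: "(complex ^ 2 \<Rightarrow> ereal) \<Rightarrow> complex \<times> complex \<Rightarrow> real" where
  "extend0 u p = (if norm p < 1 then real_of_ereal (u (vec_of p)) else 0)"

context
  fixes u1 u2 :: "complex ^ 2 \<Rightarrow> ereal"
  assumes u1: "u1 \<in> neg_psh_cone (ball 0 1)" and u2: "u2 \<in> neg_psh_cone (ball 0 1)"
    and sum: "\<And>z. z \<in> ball 0 1 \<Longrightarrow> ereal (trunc_log (pair_of z)) = u1 z + u2 z"
begin

lemma summand_eq: "norm p < 1 \<Longrightarrow> u1 (vec_of p) = ereal (extend0 u1 p) \<and> u2 (vec_of p) = ereal (extend0 u2 p)"
  and summands_nonpos: "norm p < 1 \<Longrightarrow> extend0 u1 p \<le> 0 \<and> extend0 u2 p \<le> 0"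
  and extend0_add: "norm p < 1 \<Longrightarrow> extend0 u1 p + extend0 u2 p = trunc_log p"
proof -
  assume p: "norm p < 1"
  then have "u1 (vec_of p) \<le> 0" "u2 (vec_of p) \<le> 0"
    using u1 u2 by (auto simp: neg_psh_cone_def)
  moreover have "ereal (trunc_log p) = u1 (vec_of p) + u2 (vec_of p)"
    using sum[of "vec_of p"] p by simp
  ultimately show "u1 (vec_of p) = ereal (extend0 u1 p) \<and> u2 (vec_of p) = ereal (extend0 u2 p)"
    "extend0 u1 p \<le> 0 \<and> extend0 u2 p \<le> 0" "extend0 u1 p + extend0 u2 p = trunc_log p"
    using p unfolding extend0_def
    by (cases "u1 (vec_of p)"; cases "u2 (vec_of p)"; simp)+
qed

lemma extend0_usc:
  assumes u: "u = u1 \<or> u = u2" and p: "norm p < 1" and c: "extend0 u p < c"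
  shows "\<forall>\<^sub>F q in nhds p. extend0 u q < c"
proof -
  have "usc_on (ball 0 1) u" using u u1 u2 by (auto simp: neg_psh_cone_def psh_on_def)
  then have "open {x \<in> ball 0 1. u x < ereal c}"
    unfolding usc_on_def using openin_open_trans open_ball by blast
  then have "open (vec_of -` {x \<in> ball 0 1. u x < ereal c})"
    by (rule open_vimage) (intro continuous_intros)
  moreover have iff: "q \<in> vec_of -` {x \<in> ball 0 1. u x < ereal c} \<longleftrightarrow> norm q < 1 \<and> extend0 u q < c" for q
    using summand_eq[of q] u by (cases "norm q < 1") auto
  ultimately show ?thesis
    unfolding eventually_nhds using p c by blast
qed

text \<open>
\<open>u1\<close> is the difference of a continuous function and the upper semicontinuous \<open>u2\<close>.
\<close>

lemma extend0_lsc: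
  assumes p: "norm p < 1" and c: "c < extend0 u1 p"
  shows "\<forall>\<^sub>F q in nhds p. c < extend0 u1 q"
proof -
  define d where "d = (extend0 u1 p - c) / 2"
  have d: "d > 0" using c by (simp add: d_def)
  have "\<forall>\<^sub>F q in nhds p. extend0 u2 q < extend0 u2 p + d"
    using d by (intro extend0_usc p) auto
  moreover have "isCont trunc_log p"
    using continuous_on_interior[OF continuous_on_trunc_log[OF continuous_on_id[of UNIV]]] by simp
  then have "\<forall>\<^sub>F q in nhds p. trunc_log p - d < trunc_log q"
    using d by (intro order_tendstoD(1)[of _ "trunc_log p"]) (auto simp: isCont_def tendsto_at_iff_tendsto_nhds)
  moreover have "\<forall>\<^sub>F q in nhds p. norm q < 1"
    using p eventually_nhds_in_open[of "ball 0 1" p] by simp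
  ultimately show ?thesis
  proof eventually_elim
    case (elim q)
    then show ?case using extend0_add[OF p] extend0_add[of q] by (simp add: d_def field_simps)
  qed
qed

lemma continuous_extend0: "continuous_on UNIV (extend0 u1)"
  unfolding continuous_on_eq_continuous_at[OF open_UNIV]
proof
  fix p
  show "isCont (extend0 u1) p"
  proof (cases "norm p < 1")
    case True
    then have "(extend0 u1 \<longlongrightarrow> extend0 u1 p) (nhds p)"
      by (intro order_tendstoI extend0_usc extend0_lsc) auto
    then show ?thesis by (simp add: isCont_def tendsto_at_iff_tendsto_nhds)
  next
    case False
    define b where "b = (\<lambda>q. max 0 (- trunc_log q))"
    have "continuous_on UNIV b" unfolding b_def by (intro continuous_intros)
    from continuous_on_interior[OF this, of p] have "b \<midarrow>p\<rightarrow> b p" by (simp add: isCont_def)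
    moreover have "b p = 0"
    proof -
      have "trunc_log p \<ge> 0" using False by (simp add: trunc_log_def le_max_iff_disj)
      then show ?thesis by (simp add: b_def)
    qed
    moreover have "norm (extend0 u1 q) \<le> b q" for q
    proof (cases "norm q < 1")
      case True
      then show ?thesis
        using summands_nonpos[OF True] extend0_add[OF True] unfolding real_norm_def b_def by linarith
    qed (simp add: extend0_def b_def)
    ultimately have "extend0 u1 \<midarrow>p\<rightarrow> 0"
      by (intro Lim_null_comparison[of "extend0 u1" b]) auto
    then show ?thesis using False by (simp add: isCont_def extend0_def)
  qed
qed

lemma extend0_submean:
  assumes ab: "disc_in_ball a b"
  shows "0 \<le> mean_gap (extend0 u1) a b"
proof -
  let ?S = "{t. vec_of a + t *s vec_of b \<in> ball 0 1}"
  have in1: "norm (a + cscale \<omega> b) < 1" if "norm \<omega> \<le> 1" for \<omega>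
    using ab that by (simp add: disc_in_ball_def)
  have sub: "subharmonic_on ?S (\<lambda>t. u1 (vec_of a + t *s vec_of b))"
    using u1 by (simp add: neg_psh_cone_def psh_on_def)
  have "cball 0 1 \<subseteq> ?S"
    using in1 by (auto simp: vec_of_line[symmetric])
  then have "u1 (vec_of a + 0 *s vec_of b) \<le> circle_mean (\<lambda>t. u1 (vec_of a + t *s vec_of b)) 0 1"
    using sub unfolding subharmonic_on_def by (metis zero_less_one)
  also have "\<dots> = ereal (circ_avg (\<lambda>\<omega>. extend0 u1 (a + cscale \<omega> b)))"
  proof (rule circle_mean_eq_circ_avg)
    show "continuous_on (sphere 0 1) (\<lambda>\<omega>. extend0 u1 (a + cscale \<omega> b))"
      by (rule continuous_on_compose2[OF continuous_extend0]) (auto intro!: continuous_intros)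
  qed (use in1 summand_eq summands_nonpos in \<open>auto simp: vec_of_line[symmetric]\<close>)
  finally show ?thesis
    using summand_eq[of a] in1[of 0] by (simp add: mean_gap_def)
qed

end

lemma dominated_extend0:
  assumes u: "u1 \<in> neg_psh_cone (ball 0 1)" "u2 \<in> neg_psh_cone (ball 0 1)"
    and sum: "\<And>z. z \<in> ball 0 1 \<Longrightarrow> ereal (trunc_log (pair_of z)) = u1 z + u2 z"
  shows "dominated (\<lambda>p. of_real (extend0 u1 p))"
proof -
  have sum': "\<And>z. z \<in> ball 0 1 \<Longrightarrow> ereal (trunc_log (pair_of z)) = u2 z + u1 z"
    using sum by (simp add: add.commute)
  note c1 = continuous_extend0[OF u sum] and c2 = continuous_extend0[OF u(2,1) sum']
  have cont: "continuous_on (sphere 0 1) (\<lambda>\<omega>. extend0 u1 (a + cscale \<omega> b))"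
    "continuous_on (sphere 0 1) (\<lambda>\<omega>. extend0 u2 (a + cscale \<omega> b))" for a b
    by (rule continuous_on_compose2[OF c1] continuous_on_compose2[OF c2]; auto intro!: continuous_intros)+
  have "norm (mean_gap (\<lambda>p. complex_of_real (extend0 u1 p)) a b) \<le> mean_gap trunc_log a b"
    if ab: "disc_in_ball a b" for a b
  proof -
    have in1: "norm (a + cscale \<omega> b) < 1" if "norm \<omega> \<le> 1" for \<omega>
      using ab that by (simp add: disc_in_ball_def)
    have "circ_avg (\<lambda>\<omega>. trunc_log (a + cscale \<omega> b))
        = circ_avg (\<lambda>\<omega>. extend0 u1 (a + cscale \<omega> b) + extend0 u2 (a + cscale \<omega> b))"
      by (rule circ_avg_cong) (use in1 extend0_add[OF u sum] in simp)
    also have "\<dots> = circ_avg (\<lambda>\<omega>. extend0 u1 (a + cscale \<omega> b)) + circ_avg (\<lambda>\<omega>. extend0 u2 (a + cscale \<omega> b))"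
      by (intro circ_avg_add cont)
    finally have "mean_gap trunc_log a b = mean_gap (extend0 u1) a b + mean_gap (extend0 u2) a b"
      using extend0_add[OF u sum, of a] in1[of 0] by (simp add: mean_gap_def)
    moreover have "mean_gap (\<lambda>p. complex_of_real (extend0 u1 p)) a b = of_real (mean_gap (extend0 u1) a b)"
      unfolding mean_gap_def using circ_avg_of_real[OF cont(1)[of a b]] by simp
    ultimately show ?thesis
      using extend0_submean[OF u sum ab] extend0_submean[OF u(2,1) sum' ab] by simp
  qed
  moreover have "continuous_on UNIV (\<lambda>p. complex_of_real (extend0 u1 p))"
    by (intro continuous_intros c1)
  ultimately show ?thesis unfolding dominated_def by (simp add: extend0_def)
qed

lemma summand_eq_multiple:
  assumes u: "u1 \<in> neg_psh_cone (ball 0 1)" "u2 \<in> neg_psh_cone (ball 0 1)"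
    and sum: "\<And>z. z \<in> ball 0 1 \<Longrightarrow> ereal (trunc_log (pair_of z)) = u1 z + u2 z"
  shows "\<exists>l\<ge>0. \<forall>z\<in>ball 0 1. u1 z = ereal l * ereal (trunc_log (pair_of z))"
proof (intro exI conjI ballI)
  show "0 \<le> - extend0 u1 0" using summands_nonpos[OF u sum, of 0] by simp
  fix z :: "complex ^ 2" assume z: "z \<in> ball 0 1"
  have "complex_of_real (extend0 u1 (pair_of z)) = of_real (- extend0 u1 0 * trunc_log (pair_of z))"
    using dominated_eq_multiple[OF dominated_extend0[OF u sum], of "pair_of z"] z by simp
  then have "extend0 u1 (pair_of z) = - extend0 u1 0 * trunc_log (pair_of z)"
    by (simp only: of_real_eq_iff)
  then show "u1 z = ereal (- extend0 u1 0) * ereal (trunc_log (pair_of z))"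
    using summand_eq[OF u sum, of "pair_of z"] z by simp
qed

theorem mainTheorem7:
  shows "extremal_on (ball (0 :: complex ^ 2) 1) (\<lambda>z. max (log_norm z) (-1))"
  unfolding extremal_on_def
proof (intro conjI ballI impI max_log_norm_in_cone)
  fix u1 u2 :: "complex ^ 2 \<Rightarrow> ereal"
  assume u: "u1 \<in> neg_psh_cone (ball 0 1)" "u2 \<in> neg_psh_cone (ball 0 1)"
    and sum: "\<forall>z\<in>ball 0 1. max (log_norm z) (-1) = u1 z + u2 z"
  have s1: "ereal (trunc_log (pair_of z)) = u1 z + u2 z" if "z \<in> ball 0 1" for z
    using sum that unfolding max_log_norm_eq by blast
  have s2: "ereal (trunc_log (pair_of z)) = u2 z + u1 z" if "z \<in> ball 0 1" for z
    using s1[OF that] by (simp add: add.commute)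
  show "\<exists>l1 l2 :: real. l1 \<ge> 0 \<and> l2 \<ge> 0 \<and>
      (\<forall>z\<in>ball 0 1. u1 z = ereal l1 * max (log_norm z) (-1)) \<and>
      (\<forall>z\<in>ball 0 1. u2 z = ereal l2 * max (log_norm z) (-1))"
    using summand_eq_multiple[OF u s1] summand_eq_multiple[OF u(2,1) s2]
    unfolding max_log_norm_eq by blast
qed

end
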